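(* Let $0\le m,h\le n$, $0\le k\le\min\{n-m,m,n-h,h\}$ and $\max\{0,m-h\}\le w\le\min\{n-h,m\}$ be integers. Then $$C^{\frac{n-m}{2},\frac m2,\frac n2-k}_{\frac{n+m}{2}-h-w,\;w-\frac m2,\;\frac n2-h}=(-1)^k\left[\frac{(h-k)!\,(n-h-k)!\,(m-k)!\,(n-m-k)!\,(n-2k+1)}{(m-w)!\,(h-m+w)!\,(n-h-w)!\,w!\,(n-k+1)!\,k!}\right]^{1/2}E_k(n-h,h,m,w).$$
   Context: Hahn polynomials: for integers with $0\le c\le a+b$, $0\le m\le\min\{a,b,c,a+b-c\}$, $\max\{c-b,0\}\le x\le\min\{a,c\}$, $$E_m(a,b,c,x)=\sum_{r=\max\{0,x-c+m\}}^{\min\{m,x\}}(-1)^r\binom{m}{r}(b-m+1)_r(-x)_r(a-m+1)_{m-r}(x-c)_{m-r},$$ where $(x)_s=x(x+1)\cdots(x+s-1)$. Clebsch–Gordan coefficients: for $l\in\{0,\frac12,1,\frac32,\dots\}$, $V_l$ is the space of homogeneous complex polynomials of degree $2l$ in $x,y$, with $SU(2)$-action $[T^l(g)P](x,y)=P(ax+cy,bx+dy)$ for $g=\begin{pmatrix}a&b\\c&d\end{pmatrix}$; the scalar product on $V_l$ is the one for which $\psi^l_j=\sqrt{\binom{2l}{l-j}}\,x^{l-j}y^{l+j}$, $j=-l,-l+1,\dots,l$, is an orthonormal basis. One has $V_{l_1}\otimes V_{l_2}\cong\bigoplus_{l=|l_1-l_2|}^{l_1+l_2}V_l$ (multiplicity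 free). For each such $l$ there is a unique isometric $SU(2)$-equivariant embedding $V_l\to V_{l_1}\otimes V_{l_2}$, $\psi^l_j\mapsto\phi^{l_1,l_2,l}_j$, such that $\langle\phi^{l_1,l_2,l}_l,\psi^{l_1}_{l_1}\otimes\psi^{l_2}_{l-l_1}\rangle>0$. The Clebsch–Gordan coefficients are defined by $$\phi^{l_1,l_2,l}_j=\sum_{j_1=-l_1}^{l_1}\sum_{j_2=-l_2}^{l_2}C^{l_1,l_2,l}_{j_1,j_2,j}\,\psi^{l_1}_{j_1}\otimes\psi^{l_2}_{j_2}.$$ *)

theory Defs
  imports "HOL-Analysis.Analysis"
begin

subsection \<open>Hahn polynomials\<close>

text \<open>
  The parameters are integers, as the arguments of the rising factorials may be negative.
  The definition is meant for
  \<open>0 \<le> c \<le> a + b\<close>, \<open>0 \<le> m \<le> min {a, b, c, a + b - c}\<close> and \<open>max {c - b, 0} \<le> x \<le> min {a, c}\<close>;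
  in the summation range \<open>r\<close> and \<open>m - r\<close> are then nonnegative, so that \<open>nat\<close> does not truncate.
\<close>

definition hahn :: "int \<Rightarrow> int \<Rightarrow> int \<Rightarrow> int \<Rightarrow> int \<Rightarrow> int" where
  "hahn m a b c x =
    (\<Sum>r \<in> {max 0 (x - c + m)..min m x}.
      (-1) ^ nat r * int (nat m choose nat r)
        * pochhammer (b - m + 1) (nat r) * pochhammer (- x) (nat r)
        * pochhammer (a - m + 1) (nat (m - r)) * pochhammer (x - c) (nat (m - r)))"

subsection \<open>The representations \<open>V\<^sub>l\<close> of \<open>SU(2)\<close>\<close>

text \<open>
  Spins \<open>l\<close> and weights \<open>j\<close> are half-integers inside the reals.  Polynomials with complex
  coefficients in \<open>x, y\<close> are identified with the functions on \<open>\<complex>\<^sup>2\<close> which they induce (the field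
  being infinite, this is faithful), and elements of \<open>V\<^bsub>l1\<^esub> \<otimes> V\<^bsub>l2\<^esub>\<close> with functions on \<open>\<complex>\<^sup>2 \<times> \<complex>\<^sup>2\<close>,
  where \<open>(P \<otimes> Q) (p, q) = P p * Q q\<close>.
\<close>

text \<open>For a spin \<open>l\<close> this is the set \<open>{-l, -l + 1, \<dots>, l}\<close>.\<close>

definition weights :: "real \<Rightarrow> real set" where
  "weights l = {j. l - j \<in> \<nat> \<and> l + j \<in> \<nat>}"

definition hpolys :: "real \<Rightarrow> (complex \<times> complex \<Rightarrow> complex) set" where
  "hpolys l = {P. \<exists>c :: nat \<Rightarrow> complex. \<forall>x y.
     P (x, y) = (\<Sum>i\<le>nat \<lfloor>2 * l\<rfloor>. c i * x ^ i * y ^ (nat \<lfloor>2 * l\<rfloor> - i))}"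

definition psi :: "real \<Rightarrow> real \<Rightarrow> complex \<times> complex \<Rightarrow> complex" where
  "psi l j = (\<lambda>(x, y). complex_of_real (sqrt (real (nat \<lfloor>2 * l\<rfloor> choose nat \<lfloor>l - j\<rfloor>)))
     * x ^ nat \<lfloor>l - j\<rfloor> * y ^ nat \<lfloor>l + j\<rfloor>)"

definition tensor ::
  "('p \<Rightarrow> complex) \<Rightarrow> ('q \<Rightarrow> complex) \<Rightarrow> 'p \<times> 'q \<Rightarrow> complex"  (infixr "\<otimes>\<^sub>t" 70) where
  "P \<otimes>\<^sub>t Q = (\<lambda>(p, q). P p * Q q)"

definition tensor_space :: "real \<Rightarrow> real \<Rightarrow>
    ((complex \<times> complex) \<times> (complex \<times> complex) \<Rightarrow> complex) set" where
  "tensor_space l1 l2 = {F. \<exists>(N :: nat) P Q. (\<forall>i<N. P i \<in> hpolys l1 \<and> Q i \<in> hpolys l2) \<and>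
     F = (\<lambda>z. \<Sum>i<N. (P i \<otimes>\<^sub>t Q i) z)}"

definition SU2 :: "(complex^2^2) set" where
  "SU2 = {g. g ** map_matrix cnj (transpose g) = mat 1 \<and> det g = 1}"

text \<open>The row vector \<open>(x, y)\<close> times the matrix \<open>g\<close>.\<close>

definition subst :: "complex^2^2 \<Rightarrow> complex \<times> complex \<Rightarrow> complex \<times> complex" where
  "subst g = (\<lambda>(x, y). (g$1$1 * x + g$2$1 * y, g$1$2 * x + g$2$2 * y))"

definition act :: "complex^2^2 \<Rightarrow> (complex \<times> complex \<Rightarrow> complex) \<Rightarrow> complex \<times> complex \<Rightarrow> complex" where
  "act g P = (\<lambda>p. P (subst g p))"

text \<open>This is \<open>T\<^bsup>l1\<^esup>(g) \<otimes> T\<^bsup>l2\<^esup>(g)\<close>: it is linear and maps \<open>P \<otimes> Q\<close> to \<open>act g P \<otimes> act g Q\<close>.\<close>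

definition tensor_act :: "complex^2^2 \<Rightarrow>
    ((complex \<times> complex) \<times> (complex \<times> complex) \<Rightarrow> complex) \<Rightarrow>
    (complex \<times> complex) \<times> (complex \<times> complex) \<Rightarrow> complex" where
  "tensor_act g F = (\<lambda>(p, q). F (subst g p, subst g q))"

lemma tensor_act_tensor: "tensor_act g (P \<otimes>\<^sub>t Q) = act g P \<otimes>\<^sub>t act g Q"
  by (auto simp: tensor_act_def tensor_def act_def)

text \<open>
  Coordinates of \<open>F\<close> with respect to a finite basis \<open>(b i)\<^bsub>i \<in> I\<^esub>\<close> of a space of functions
  (normalised to \<open>0\<close> off \<open>I\<close>), and the scalar product for which that basis is orthonormal.
\<close>

definition coord :: "'i set \<Rightarrow> ('i \<Rightarrow> 'a \<Rightarrow> complex) \<Rightarrow> ('a \<Rightarrow> complex) \<Rightarrow> 'i \<Rightarrow> complex" where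
  "coord I b F = (THE c. (\<forall>i. i \<notin> I \<longrightarrow> c i = 0) \<and> F = (\<lambda>z. \<Sum>i\<in>I. c i * b i z))"

definition basis_inner ::
  "'i set \<Rightarrow> ('i \<Rightarrow> 'a \<Rightarrow> complex) \<Rightarrow> ('a \<Rightarrow> complex) \<Rightarrow> ('a \<Rightarrow> complex) \<Rightarrow> complex" where
  "basis_inner I b F G = (\<Sum>i\<in>I. coord I b F i * cnj (coord I b G i))"

definition inner_V ::
  "real \<Rightarrow> (complex \<times> complex \<Rightarrow> complex) \<Rightarrow> (complex \<times> complex \<Rightarrow> complex) \<Rightarrow> complex" where
  "inner_V l = basis_inner (weights l) (psi l)"

definition psi_tensor :: "real \<Rightarrow> real \<Rightarrow> real \<times> real \<Rightarrow>
    (complex \<times> complex) \<times> (complex \<times> complex) \<Rightarrow> complex" where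
  "psi_tensor l1 l2 = (\<lambda>(j1, j2). psi l1 j1 \<otimes>\<^sub>t psi l2 j2)"

text \<open>
  The scalar product on the tensor product, \<open>\<langle>P \<otimes> Q, P' \<otimes> Q'\<rangle> = \<langle>P, P'\<rangle> \<langle>Q, Q'\<rangle>\<close>, is the one for
  which the tensors of the two orthonormal bases are orthonormal.
\<close>

definition inner_tensor :: "real \<Rightarrow> real \<Rightarrow>
    ((complex \<times> complex) \<times> (complex \<times> complex) \<Rightarrow> complex) \<Rightarrow>
    ((complex \<times> complex) \<times> (complex \<times> complex) \<Rightarrow> complex) \<Rightarrow> complex" where
  "inner_tensor l1 l2 = basis_inner (weights l1 \<times> weights l2) (psi_tensor l1 l2)"

subsection \<open>Clebsch--Gordan coefficients\<close>

text \<open>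
  The meaningful parameters are spins \<open>l1, l2\<close> and \<open>l \<in> {\<bar>l1 - l2\<bar>, \<bar>l1 - l2\<bar> + 1, \<dots>, l1 + l2}\<close>.
  The space \<open>\<rightarrow>\<^sub>E\<close> fixes the value of the map outside of \<open>hpolys l\<close>, so that the embedding is
  unique as a total function.
\<close>

definition is_CG_embedding :: "real \<Rightarrow> real \<Rightarrow> real \<Rightarrow>
    ((complex \<times> complex \<Rightarrow> complex) \<Rightarrow> (complex \<times> complex) \<times> (complex \<times> complex) \<Rightarrow> complex) \<Rightarrow> bool" where
  "is_CG_embedding l1 l2 l \<Phi> \<longleftrightarrow>
     \<Phi> \<in> hpolys l \<rightarrow>\<^sub>E tensor_space l1 l2 \<and>
     (\<forall>P \<in> hpolys l. \<forall>Q \<in> hpolys l. \<forall>s t.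
        \<Phi> (\<lambda>p. s * P p + t * Q p) = (\<lambda>z. s * \<Phi> P z + t * \<Phi> Q z)) \<and>
     (\<forall>P \<in> hpolys l. \<forall>Q \<in> hpolys l. inner_tensor l1 l2 (\<Phi> P) (\<Phi> Q) = inner_V l P Q) \<and>
     (\<forall>g \<in> SU2. \<forall>P \<in> hpolys l. \<Phi> (act g P) = tensor_act g (\<Phi> P)) \<and>
     (let v = inner_tensor l1 l2 (\<Phi> (psi l l)) (psi l1 l1 \<otimes>\<^sub>t psi l2 (l - l1))
      in v \<in> \<real> \<and> Re v > 0)"

definition CG_embedding :: "real \<Rightarrow> real \<Rightarrow> real \<Rightarrow>
    (complex \<times> complex \<Rightarrow> complex) \<Rightarrow> (complex \<times> complex) \<times> (complex \<times> complex) \<Rightarrow> complex" where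
  "CG_embedding l1 l2 l = (THE \<Phi>. is_CG_embedding l1 l2 l \<Phi>)"

definition phi :: "real \<Rightarrow> real \<Rightarrow> real \<Rightarrow> real \<Rightarrow>
    (complex \<times> complex) \<times> (complex \<times> complex) \<Rightarrow> complex" where
  "phi l1 l2 l j = CG_embedding l1 l2 l (psi l j)"

text \<open>
  \<open>clebsch_gordan l1 l2 l j1 j2 j\<close> is the coefficient \<open>C\<^bsup>l1,l2,l\<^esup>\<^bsub>j1,j2,j\<^esub>\<close>, that is,
  \<open>phi l1 l2 l j\<close> is the sum of the \<open>C\<^bsup>l1,l2,l\<^esup>\<^bsub>j1,j2,j\<^esub> \<psi>\<^bsup>l1\<^esup>\<^bsub>j1\<^esub> \<otimes> \<psi>\<^bsup>l2\<^esup>\<^bsub>j2\<^esub>\<close>.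
\<close>

definition clebsch_gordan :: "real \<Rightarrow> real \<Rightarrow> real \<Rightarrow> real \<Rightarrow> real \<Rightarrow> real \<Rightarrow> complex" where
  "clebsch_gordan l1 l2 l j1 j2 j =
     coord (weights l1 \<times> weights l2) (psi_tensor l1 l2) (phi l1 l2 l j) (j1, j2)"

end

theory Submission
  imports Defs
begin

text \<open>
  Write \<open>A = n - m\<close>, \<open>B = m\<close>, \<open>D = n - 2k\<close>, so that \<open>A + B = D + 2k\<close> and the spins are \<open>A/2, B/2, D/2\<close>.

  The embedding of \<open>V\<^bsub>D/2\<^esub>\<close> into the tensor product is classical: up to a constant it sends a form \<open>P\<close>
  to \<open>(x2 y1 - x1 y2)^k\<close> times the coefficient of \<open>t^(B - k)\<close> in \<open>P (p + t q)\<close>, where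
  \<open>p = (x1, y1)\<close> and \<open>q = (x2, y2)\<close>.  The determinant is invariant under matrices of determinant \<open>1\<close>
  and \<open>p + t q\<close> transforms like \<open>p\<close>, so equivariance is visible (\<open>cg_map_equivariant\<close>).  Expanding by the
  binomial theorem, its matrix coefficients are the sums \<open>cg_sum\<close> of products of binomial coefficients
  (\<open>cg_map_hmono\<close>), and a double use of Vandermonde's identity turns such a sum into a Hahn
  polynomial (\<open>hahn_eq_cg_sum\<close>).

  It remains to see that there is no other embedding and that this one, suitably scaled, is isometric.
  Both follow from differentiating the equivariance of a map \<open>\<Phi>\<close> along three one-parameter subgroups of
  \<open>SU(2)\<close> (\<open>intertwiner_deriv\<close>): the images of the monomials \<open>x^i y^(D - i)\<close> are weight vectors, and
  the raising and lowering operators move them up and down (\<open>intertwiner_ladder\<close>,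
  \<open>intertwiner_weight\<close>).
  Raising kills the image of \<open>y^D\<close>, which determines that image up to a scalar
  (\<open>intertwiner_highest_weight\<close>); lowering then determines the images of all other monomials
  (\<open>intertwiner_eqI\<close>).  Since raising and lowering are adjoint to each other for the scalar product
  (\<open>lower_raise_adjoint\<close>), the norms of the images along the ladder have the same ratios as in
  \<open>V\<^bsub>D/2\<^esub>\<close>, so that \<open>\<Phi>\<close> multiplies the scalar product by a constant (\<open>intertwiner_inner\<close>).
  That constant is read off from the highest weight vector, where it is again a Vandermonde sum
  (\<open>highest_weight_norm_sq_eq\<close>).
\<close>

section \<open>Coefficients of polynomial functions by Fourier inversion\<close>

text \<open>
  A linear functional defined on all functions, which for a polynomial of degree at most \<open>N\<close> returns
  the coefficient of \<open>t^e\<close>.  Being a finite combination of point evaluations, it commutes with sums,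
  with linear maps of the values and with differentiation in a parameter.
\<close>

definition dft_coeff :: "nat \<Rightarrow> nat \<Rightarrow> (complex \<Rightarrow> complex) \<Rightarrow> complex" where
  "dft_coeff N e f = (\<Sum>j\<le>N. cis (- (2 * pi * real j * real e / real (N + 1)))
      * f (cis (2 * pi * real j / real (N + 1)))) / of_nat (N + 1)"

text \<open>
  A geometric sum over the powers of an \<open>(N + 1)\<close>-st root of unity; for \<open>d \<noteq> 0\<close> this root is not
  \<open>1\<close>, because \<open>\<bar>d\<bar> < N + 1\<close>.
\<close>

lemma sum_cis_roots:
  fixes d :: int and N :: nat
  assumes "\<bar>d\<bar> \<le> int N"
  shows "(\<Sum>j\<le>N. cis (2 * pi * real j * real_of_int d / real (N + 1))) = (if d = 0 then of_nat (N + 1) else 0)"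
proof (cases "d = 0")
  case False
  define z where "z = cis (2 * pi * real_of_int d / real (N + 1))"
  have pw: "cis (2 * pi * real j * real_of_int d / real (N + 1)) = z ^ j" for j
    unfolding z_def Complex.DeMoivre by (rule arg_cong[of _ _ cis]) simp
  have "z ^ Suc N = cis (2 * pi * real_of_int d)"
    unfolding z_def Complex.DeMoivre by (rule arg_cong[of _ _ cis]) simp
  then have zN: "z ^ Suc N = 1"
    by (simp add: cis_multiple_2pi)
  have "z \<noteq> 1"
  proof
    assume "z = 1"
    then have "cos (2 * pi * real_of_int d / real (N + 1)) = 1"
      unfolding z_def by (metis cis.sel(1) one_complex.sel(1))
    then obtain q :: int where "2 * pi * real_of_int d / real (N + 1) = of_int q * 2 * pi"
      using cos_one_2pi_int by auto
    then have "2 * pi * real_of_int d = of_int q * 2 * pi * real (N + 1)"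
      by (simp add: divide_eq_eq del: of_nat_add)
    then have "(2 * pi) * real_of_int d = (2 * pi) * (real_of_int q * real (N + 1))"
      by (simp only: mult_ac)
    then have "real_of_int d = real_of_int q * real (N + 1)"
      by (subst (asm) mult_left_cancel) auto
    then have "d = q * int (N + 1)"
      by (metis of_int_eq_iff of_int_mult of_int_of_nat_eq)
    then have "int (N + 1) dvd d" by simp
    then have "int (N + 1) \<le> \<bar>d\<bar>"
      using False dvd_imp_le_int by force
    with assms show False by simp
  qed
  then have "(\<Sum>j<Suc N. z ^ j) = 0"
    using geometric_sum[of z "Suc N"] zN by simp
  then show ?thesis
    using False unfolding pw lessThan_Suc_atMost by simp
qed simp

lemma dft_coeff_polynomial:
  assumes "e \<le> N"
  shows "dft_coeff N e (\<lambda>t. \<Sum>i\<le>N. c i * t ^ i) = c e"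
proof -
  have *: "cis (- (2 * pi * real j * real e / real (N + 1))) * cis (2 * pi * real j / real (N + 1)) ^ i
      = cis (2 * pi * real j * real_of_int (int i - int e) / real (N + 1))" for i j
    unfolding Complex.DeMoivre cis_mult
    by (rule arg_cong[of _ _ cis]) (simp add: diff_divide_distrib right_diff_distrib)
  have "(\<Sum>j\<le>N. cis (- (2 * pi * real j * real e / real (N + 1)))
      * (\<Sum>i\<le>N. c i * cis (2 * pi * real j / real (N + 1)) ^ i))
      = (\<Sum>j\<le>N. \<Sum>i\<le>N. c i * cis (2 * pi * real j * real_of_int (int i - int e) / real (N + 1)))"
    unfolding *[symmetric] sum_distrib_left by (intro sum.cong refl) (simp add: mult_ac)
  also have "\<dots> = (\<Sum>i\<le>N. c i * (\<Sum>j\<le>N. cis (2 * pi * real j * real_of_int (int i - int e) / real (N + 1))))"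
    by (subst sum.swap) (simp add: sum_distrib_left)
  also have "\<dots> = (\<Sum>i\<le>N. if i = e then c i * of_nat (N + 1) else 0)"
    using assms by (intro sum.cong refl) (subst sum_cis_roots, auto)
  also have "\<dots> = c e * of_nat (N + 1)"
    using assms by simp
  finally show ?thesis
    unfolding dft_coeff_def by (simp add: add.commute del: of_nat_Suc of_nat_add)
qed

lemma dft_coeff_add: "dft_coeff N e (\<lambda>t. f t + g t) = dft_coeff N e f + dft_coeff N e g"
  by (simp add: dft_coeff_def sum.distrib distrib_left add_divide_distrib)

lemma dft_coeff_cmult: "dft_coeff N e (\<lambda>t. s * f t) = s * dft_coeff N e f"
  by (simp add: dft_coeff_def sum_distrib_left mult_ac)

lemma dft_coeff_sum: "dft_coeff N e (\<lambda>t. \<Sum>i\<in>I. f i t) = (\<Sum>i\<in>I. dft_coeff N e (f i))"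
  unfolding dft_coeff_def sum_divide_distrib sum_distrib_left by (rule sum.swap)

lemma dft_coeff_deriv:
  assumes "\<And>t. ((\<lambda>z. f z t) has_field_derivative f' t) (at z0)"
  shows "((\<lambda>z. dft_coeff N e (f z)) has_field_derivative dft_coeff N e f') (at z0)"
  unfolding dft_coeff_def by (intro DERIV_cdivide DERIV_sum DERIV_cmult assms)

section \<open>Monomial coordinates on \<open>V\<^sub>l\<close> and on tensor products\<close>

definition hmono :: "nat \<Rightarrow> nat \<Rightarrow> complex \<times> complex \<Rightarrow> complex" where
  "hmono N i = (\<lambda>(x, y). x ^ i * y ^ (N - i))"

text \<open>
  A form of degree \<open>N\<close> is determined by its restriction to the line \<open>y = 1\<close>; this is where the
  coefficients are read off.
\<close>

definition hcoeff :: "nat \<Rightarrow> (complex \<times> complex \<Rightarrow> complex) \<Rightarrow> nat \<Rightarrow> complex" where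
  "hcoeff N P i = dft_coeff N i (\<lambda>t. P (t, 1))"

definition tcoeff :: "nat \<Rightarrow> nat \<Rightarrow> ((complex \<times> complex) \<times> (complex \<times> complex) \<Rightarrow> complex) \<Rightarrow>
    nat \<Rightarrow> nat \<Rightarrow> complex" where
  "tcoeff A B F a b = dft_coeff A a (\<lambda>s. dft_coeff B b (\<lambda>t. F ((s, 1), (t, 1))))"

lemma mem_hpolys_iff: "P \<in> hpolys (real N / 2) \<longleftrightarrow> (\<exists>c. P = (\<lambda>p. \<Sum>i\<le>N. c i * hmono N i p))"
  by (auto simp: hpolys_def hmono_def fun_eq_iff mult.assoc)

lemma hcoeff_sum:
  "i \<le> N \<Longrightarrow> hcoeff N (\<lambda>p. \<Sum>j\<le>N. c j * hmono N j p) i = c i"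
  by (simp add: hcoeff_def hmono_def dft_coeff_polynomial)

lemma hpolys_expand:
  assumes "P \<in> hpolys (real N / 2)"
  shows "P = (\<lambda>p. \<Sum>i\<le>N. hcoeff N P i * hmono N i p)"
  using assms by (auto simp: mem_hpolys_iff hcoeff_sum)

lemma hmono_in_hpolys: "i \<le> N \<Longrightarrow> hmono N i \<in> hpolys (real N / 2)"
  unfolding mem_hpolys_iff by (rule exI[of _ "\<lambda>j. of_bool (j = i)"]) (auto simp: fun_eq_iff)

lemma hcoeff_hmono: "i \<le> N \<Longrightarrow> j \<le> N \<Longrightarrow> hcoeff N (hmono N j) i = of_bool (i = j)"
  using hcoeff_sum[of i N "\<lambda>i. of_bool (i = j)"] by simp

lemma tcoeff_sum:
  assumes "a \<le> A" "b \<le> B"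
  shows "tcoeff A B (\<lambda>(p, q). \<Sum>i\<le>A. \<Sum>j\<le>B. c i j * hmono A i p * hmono B j q) a b = c a b"
proof -
  have "(\<Sum>i\<le>A. \<Sum>j\<le>B. c i j * s ^ i * t ^ j) = (\<Sum>j\<le>B. (\<Sum>i\<le>A. c i j * s ^ i) * t ^ j)" for s t :: complex
    by (subst sum.swap) (simp add: sum_distrib_right)
  then show ?thesis
    using assms by (simp add: tcoeff_def hmono_def dft_coeff_polynomial)
qed

text \<open>
  Finite sums of tensors of forms are the bihomogeneous forms of bidegree \<open>(A, B)\<close>; conversely, such
  a form is sorted by its monomials in the first pair of variables.
\<close>

lemma mem_tensor_space_iff:
  "F \<in> tensor_space (real A / 2) (real B / 2) \<longleftrightarrow>
    (\<exists>c. F = (\<lambda>(p, q). \<Sum>i\<le>A. \<Sum>j\<le>B. c i j * hmono A i p * hmono B j q))" (is "?l \<longleftrightarrow> ?r")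
proof
  assume ?l
  then obtain N :: nat and P Q where PQ: "\<And>i. i < N \<Longrightarrow> P i \<in> hpolys (real A / 2)"
    "\<And>i. i < N \<Longrightarrow> Q i \<in> hpolys (real B / 2)" and F: "F = (\<lambda>z. \<Sum>i<N. (P i \<otimes>\<^sub>t Q i) z)"
    unfolding tensor_space_def by blast
  have "F = (\<lambda>(p, q). \<Sum>i\<le>A. \<Sum>j\<le>B. (\<Sum>n<N. hcoeff A (P n) i * hcoeff B (Q n) j) * hmono A i p * hmono B j q)"
  proof (rule ext, clarify)
    fix x1 y1 x2 y2 :: complex
    let ?p = "(x1, y1)" and ?q = "(x2, y2)"
    have "F (?p, ?q) = (\<Sum>n<N. P n ?p * Q n ?q)"
      by (simp add: F tensor_def)
    also have "\<dots> = (\<Sum>n<N. (\<Sum>i\<le>A. hcoeff A (P n) i * hmono A i ?p) * (\<Sum>j\<le>B. hcoeff B (Q n) j * hmono B j ?q))"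
    proof (intro sum.cong refl arg_cong2[of _ _ _ _ times])
      fix n assume "n \<in> {..<N}"
      then have n: "n < N" by simp
      show "P n ?p = (\<Sum>i\<le>A. hcoeff A (P n) i * hmono A i ?p)"
        using hpolys_expand[OF PQ(1)[OF n]] by (rule fun_cong)
      show "Q n ?q = (\<Sum>j\<le>B. hcoeff B (Q n) j * hmono B j ?q)"
        using hpolys_expand[OF PQ(2)[OF n]] by (rule fun_cong)
    qed
    also have "\<dots> = (\<Sum>n<N. \<Sum>i\<le>A. \<Sum>j\<le>B. hcoeff A (P n) i * hcoeff B (Q n) j * hmono A i ?p * hmono B j ?q)"
      unfolding sum_product by (intro sum.cong refl) (simp add: mult_ac)
    also have "\<dots> = (\<Sum>i\<le>A. \<Sum>j\<le>B. (\<Sum>n<N. hcoeff A (P n) i * hcoeff B (Q n) j) * hmono A i ?p * hmono B j ?q)"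
      unfolding sum_distrib_right
      by (subst sum.swap, rule sum.cong[OF refl], subst sum.swap, rule refl)
    finally show "F (?p, ?q) = \<dots>" .
  qed
  then show ?r by (rule exI[where x = "\<lambda>i j. \<Sum>n<N. hcoeff A (P n) i * hcoeff B (Q n) j"])
next
  assume ?r
  then obtain c where c: "F = (\<lambda>(p, q). \<Sum>i\<le>A. \<Sum>j\<le>B. c i j * hmono A i p * hmono B j q)" by blast
  have "F = (\<lambda>z. \<Sum>i<Suc A. (hmono A i \<otimes>\<^sub>t (\<lambda>q. \<Sum>j\<le>B. c i j * hmono B j q)) z)"
    unfolding c lessThan_Suc_atMost
    by (auto simp: fun_eq_iff tensor_def sum_distrib_left mult_ac)
  moreover have "\<forall>i<Suc A. hmono A i \<in> hpolys (real A / 2) \<and>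
      (\<lambda>q. \<Sum>j\<le>B. c i j * hmono B j q) \<in> hpolys (real B / 2)"
    by (simp add: hmono_in_hpolys) (auto simp: mem_hpolys_iff)
  ultimately show ?l
    unfolding tensor_space_def by (intro CollectI exI conjI) assumption+
qed

lemma tensor_space_expand:
  assumes "F \<in> tensor_space (real A / 2) (real B / 2)"
  shows "F = (\<lambda>(p, q). \<Sum>i\<le>A. \<Sum>j\<le>B. tcoeff A B F i j * hmono A i p * hmono B j q)"
proof -
  from assms obtain c where c: "F = (\<lambda>(p, q). \<Sum>i\<le>A. \<Sum>j\<le>B. c i j * hmono A i p * hmono B j q)"
    unfolding mem_tensor_space_iff by blast
  have "i \<le> A \<Longrightarrow> j \<le> B \<Longrightarrow> tcoeff A B F i j = c i j" for i j
    unfolding c by (rule tcoeff_sum)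
  then show ?thesis
    by (subst c) (auto simp: fun_eq_iff intro!: sum.cong)
qed

lemma hpolys_sum:
  assumes "\<And>i. i \<in> I \<Longrightarrow> f i \<in> hpolys (real N / 2)"
  shows "(\<lambda>p. \<Sum>i\<in>I. c i * f i p) \<in> hpolys (real N / 2)"
proof -
  have "(\<lambda>p. \<Sum>i\<in>I. c i * f i p) = (\<lambda>p. \<Sum>j\<le>N. (\<Sum>i\<in>I. c i * hcoeff N (f i) j) * hmono N j p)"
  proof
    fix p
    have "(\<Sum>i\<in>I. c i * f i p) = (\<Sum>i\<in>I. c i * (\<Sum>j\<le>N. hcoeff N (f i) j * hmono N j p))"
    proof (intro sum.cong refl arg_cong2[of _ _ _ _ times])
      fix i assume "i \<in> I"
      then show "f i p = (\<Sum>j\<le>N. hcoeff N (f i) j * hmono N j p)"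
        by (rule fun_cong[OF hpolys_expand[OF assms]])
    qed
    also have "\<dots> = (\<Sum>j\<le>N. (\<Sum>i\<in>I. c i * hcoeff N (f i) j) * hmono N j p)"
      unfolding sum_distrib_left sum_distrib_right by (subst sum.swap) (simp add: mult.assoc)
    finally show "(\<Sum>i\<in>I. c i * f i p) = \<dots>" .
  qed
  then show ?thesis
    unfolding mem_hpolys_iff by (rule exI[where x = "\<lambda>j. \<Sum>i\<in>I. c i * hcoeff N (f i) j"])
qed

lemma hpolys_lincomb:
  assumes "P \<in> hpolys (real D / 2)" "Q \<in> hpolys (real D / 2)"
  shows "(\<lambda>p. s * P p + t * Q p) \<in> hpolys (real D / 2)"
  using hpolys_sum[of "UNIV :: bool set" "\<lambda>i. if i then P else Q" D "\<lambda>i. if i then s else t"] assms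
  by (simp add: UNIV_bool add.commute)

lemma tensor_space_sum:
  assumes "\<And>i. i \<in> I \<Longrightarrow> F i \<in> tensor_space (real A / 2) (real B / 2)"
  shows "(\<lambda>z. \<Sum>i\<in>I. c i * F i z) \<in> tensor_space (real A / 2) (real B / 2)"
proof -
  have "(\<lambda>z. \<Sum>i\<in>I. c i * F i z)
    = (\<lambda>(p, q). \<Sum>a\<le>A. \<Sum>b\<le>B. (\<Sum>i\<in>I. c i * tcoeff A B (F i) a b) * hmono A a p * hmono B b q)"
  proof (rule ext, clarify)
    fix x1 y1 x2 y2 :: complex
    let ?p = "(x1, y1)" and ?q = "(x2, y2)"
    have "(\<Sum>i\<in>I. c i * F i (?p, ?q)) = (\<Sum>i\<in>I. c i * (\<Sum>a\<le>A. \<Sum>b\<le>B. tcoeff A B (F i) a b * hmono A a ?p * hmono B b ?q))"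
    proof (intro sum.cong refl arg_cong2[of _ _ _ _ times])
      fix i assume "i \<in> I"
      from fun_cong[OF tensor_space_expand[OF assms[OF this]], of "(?p, ?q)"]
      show "F i (?p, ?q) = (\<Sum>a\<le>A. \<Sum>b\<le>B. tcoeff A B (F i) a b * hmono A a ?p * hmono B b ?q)"
        by simp
    qed
    also have "\<dots> = (\<Sum>a\<le>A. \<Sum>i\<in>I. \<Sum>b\<le>B. c i * (tcoeff A B (F i) a b * hmono A a ?p * hmono B b ?q))"
      unfolding sum_distrib_left by (rule sum.swap)
    also have "\<dots> = (\<Sum>a\<le>A. \<Sum>b\<le>B. \<Sum>i\<in>I. c i * (tcoeff A B (F i) a b * hmono A a ?p * hmono B b ?q))"
      by (intro sum.cong refl sum.swap)
    finally show "(\<Sum>i\<in>I. c i * F i (?p, ?q)) = (\<Sum>a\<le>A. \<Sum>b\<le>B. (\<Sum>i\<in>I. c i * tcoeff A B (F i) a b) * hmono A a ?p * hmono B b ?q)"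
      unfolding sum_distrib_right by (simp only: mult.assoc)
  qed
  then show ?thesis
    unfolding mem_tensor_space_iff
    by (rule exI[where x = "\<lambda>a b. \<Sum>i\<in>I. c i * tcoeff A B (F i) a b"])
qed

lemma act_hmono_in_hpolys:
  assumes "i \<le> N"
  shows "act g (hmono N i) \<in> hpolys (real N / 2)"
proof -
  define p q r s where "p = g$1$1" "q = g$1$2" "r = g$2$1" "s = g$2$2"
  have "act g (hmono N i) = (\<lambda>v. \<Sum>(m, n)\<in>{..i} \<times> {..N - i}.
      (of_nat (i choose m) * p ^ m * r ^ (i - m) * of_nat (N - i choose n) * q ^ n * s ^ (N - i - n))
        * hmono N (m + n) v)"
  proof (rule ext, clarify)
    fix x y :: complex
    have "act g (hmono N i) (x, y) = (\<Sum>m\<le>i. of_nat (i choose m) * (p * x) ^ m * (r * y) ^ (i - m))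
       * (\<Sum>n\<le>N - i. of_nat (N - i choose n) * (q * x) ^ n * (s * y) ^ (N - i - n))"
      by (simp add: act_def hmono_def subst_def p_q_r_s_def binomial_ring)
    also have "\<dots> = (\<Sum>m\<le>i. \<Sum>n\<le>N - i. (of_nat (i choose m) * p ^ m * r ^ (i - m) * of_nat (N - i choose n) * q ^ n * s ^ (N - i - n))
        * hmono N (m + n) (x, y))"
      unfolding sum_product
    proof (intro sum.cong refl)
      fix m n assume "m \<in> {..i}" "n \<in> {..N - i}"
      then have "N - (m + n) = (i - m) + (N - i - n)" using assms by auto
      then show "of_nat (i choose m) * (p * x) ^ m * (r * y) ^ (i - m) * (of_nat (N - i choose n) * (q * x) ^ n * (s * y) ^ (N - i - n))
        = (of_nat (i choose m) * p ^ m * r ^ (i - m) * of_nat (N - i choose n) * q ^ n * s ^ (N - i - n)) * hmono N (m + n) (x, y)"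
        by (simp add: hmono_def power_mult_distrib power_add)
    qed
    finally show "act g (hmono N i) (x, y) = (\<Sum>(m, n)\<in>{..i} \<times> {..N - i}.
      (of_nat (i choose m) * p ^ m * r ^ (i - m) * of_nat (N - i choose n) * q ^ n * s ^ (N - i - n))
        * hmono N (m + n) (x, y))"
      by (simp add: sum.cartesian_product)
  qed
  moreover have "\<dots> \<in> hpolys (real N / 2)"
    unfolding case_prod_unfold using assms by (intro hpolys_sum hmono_in_hpolys) auto
  ultimately show ?thesis by simp
qed

lemma act_in_hpolys:
  assumes "P \<in> hpolys (real N / 2)"
  shows "act g P \<in> hpolys (real N / 2)"
proof -
  have "act g P = (\<lambda>p. \<Sum>i\<le>N. hcoeff N P i * act g (hmono N i) p)"
    by (subst hpolys_expand[OF assms]) (simp add: act_def)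
  also have "\<dots> \<in> hpolys (real N / 2)"
    by (intro hpolys_sum act_hmono_in_hpolys) simp
  finally show ?thesis .
qed

lemma weights_eq: "weights (real N / 2) = (\<lambda>i. real N / 2 - real i) ` {..N}"
proof (intro equalityI subsetI)
  fix j assume "j \<in> weights (real N / 2)"
  then obtain i i' :: nat where i: "real N / 2 - j = real i" "real N / 2 + j = real i'"
    unfolding weights_def by (auto elim!: Nats_cases)
  then have "real i + real i' = real N" by linarith
  then have "i \<le> N" by linarith
  with i(1) show "j \<in> (\<lambda>i. real N / 2 - real i) ` {..N}"
    by (intro image_eqI[of _ _ i]) auto
next
  fix j assume "j \<in> (\<lambda>i. real N / 2 - real i) ` {..N}"
  then obtain i where i: "i \<le> N" "j = real N / 2 - real i" by auto
  have "real N / 2 - j = of_nat i" "real N / 2 + j = of_nat (N - i)"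
    using i by (auto simp: of_nat_diff)
  then show "j \<in> weights (real N / 2)"
    unfolding weights_def by (metis (mono_tags, lifting) mem_Collect_eq of_nat_in_Nats)
qed

lemma inj_on_weights: "inj_on (\<lambda>i. real N / 2 - real i) X"
  by (auto simp: inj_on_def)

lemma psi_eq:
  assumes "i \<le> N"
  shows "psi (real N / 2) (real N / 2 - real i) = (\<lambda>p. of_real (sqrt (real (N choose i))) * hmono N i p)"
proof -
  have "real N / 2 + (real N / 2 - real i) = real (N - i)"
    using assms by (simp add: of_nat_diff)
  then have "nat \<lfloor>real N / 2 + (real N / 2 - real i)\<rfloor> = N - i"
    by (simp only: floor_of_nat nat_int)
  moreover have "nat \<lfloor>real N / 2 - (real N / 2 - real i)\<rfloor> = i"
    by simp
  ultimately show ?thesis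
    by (auto simp: psi_def hmono_def fun_eq_iff)
qed

text \<open>
  The \<open>psi\<close> basis consists of multiples of monomials, so monomial coefficients give existence and
  uniqueness of the coordinates at once.
\<close>

lemma coord_psi:
  assumes "P \<in> hpolys (real N / 2)" "i \<le> N"
  shows "coord (weights (real N / 2)) (psi (real N / 2)) P (real N / 2 - real i)
    = hcoeff N P i / of_real (sqrt (real (N choose i)))"
proof -
  define c0 where "c0 = (\<lambda>j. if j \<in> weights (real N / 2)
    then hcoeff N P (nat \<lfloor>real N / 2 - j\<rfloor>) / of_real (sqrt (real (N choose nat \<lfloor>real N / 2 - j\<rfloor>))) else 0)"
  let ?Q = "\<lambda>c. (\<forall>j. j \<notin> weights (real N / 2) \<longrightarrow> c j = 0) \<and>
    P = (\<lambda>z. \<Sum>j\<in>weights (real N / 2). c j * psi (real N / 2) j z)"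
  have c0: "c0 (real N / 2 - real i) = hcoeff N P i / of_real (sqrt (real (N choose i)))" if "i \<le> N" for i
    using that by (simp add: c0_def weights_eq)
  have sum: "(\<lambda>z. \<Sum>j\<in>weights (real N / 2). c j * psi (real N / 2) j z)
     = (\<lambda>z. \<Sum>i\<le>N. (c (real N / 2 - real i) * of_real (sqrt (real (N choose i)))) * hmono N i z)" for c
    unfolding weights_eq sum.reindex[OF inj_on_weights]
    by (auto simp: psi_eq mult_ac intro!: ext sum.cong)
  have "?Q c0"
  proof
    show "P = (\<lambda>z. \<Sum>j\<in>weights (real N / 2). c0 j * psi (real N / 2) j z)"
      unfolding sum by (subst hpolys_expand[OF assms(1)]) (auto simp: c0 intro!: ext sum.cong)
  qed (simp add: c0_def)
  moreover have "c = c0" if "?Q c" for c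
  proof
    fix j
    show "c j = c0 j"
    proof (cases "j \<in> weights (real N / 2)")
      case True
      then obtain i where i: "i \<le> N" "j = real N / 2 - real i" by (auto simp: weights_eq)
      have "hcoeff N P i = c j * of_real (sqrt (real (N choose i)))"
        using hcoeff_sum[OF i(1)] that unfolding sum i(2) by simp
      then show ?thesis
        using i by (simp add: c0)
    qed (use that in \<open>auto simp: c0_def\<close>)
  qed
  ultimately have "coord (weights (real N / 2)) (psi (real N / 2)) P = c0"
    unfolding coord_def by (rule the_equality)
  then show ?thesis using c0 assms(2) by simp
qed

lemma sum_Times: "(\<Sum>x\<in>A \<times> B. f x) = (\<Sum>a\<in>A. \<Sum>b\<in>B. f (a, b))"
  by (rule sum.cartesian_product')

lemma coord_psi_tensor:
  assumes F: "F \<in> tensor_space (real A / 2) (real B / 2)" and "a \<le> A" "b \<le> B"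
  shows "coord (weights (real A / 2) \<times> weights (real B / 2)) (psi_tensor (real A / 2) (real B / 2)) F
      (real A / 2 - real a, real B / 2 - real b)
    = tcoeff A B F a b / (of_real (sqrt (real (A choose a))) * of_real (sqrt (real (B choose b))))"
proof -
  let ?W = "weights (real A / 2) \<times> weights (real B / 2)"
  define c0 where "c0 = (\<lambda>(j, j'). if (j, j') \<in> ?W
    then tcoeff A B F (nat \<lfloor>real A / 2 - j\<rfloor>) (nat \<lfloor>real B / 2 - j'\<rfloor>)
     / (of_real (sqrt (real (A choose nat \<lfloor>real A / 2 - j\<rfloor>))) * of_real (sqrt (real (B choose nat \<lfloor>real B / 2 - j'\<rfloor>)))) else 0)"
  let ?Q = "\<lambda>c. (\<forall>j. j \<notin> ?W \<longrightarrow> c j = 0) \<and>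
    F = (\<lambda>z. \<Sum>j\<in>?W. c j * psi_tensor (real A / 2) (real B / 2) j z)"
  have c0: "c0 (real A / 2 - real a, real B / 2 - real b)
     = tcoeff A B F a b / (of_real (sqrt (real (A choose a))) * of_real (sqrt (real (B choose b))))"
    if "a \<le> A" "b \<le> B" for a b
    using that by (simp add: c0_def weights_eq)
  have sum: "(\<lambda>z. \<Sum>j\<in>?W. c j * psi_tensor (real A / 2) (real B / 2) j z)
     = (\<lambda>(p, q). \<Sum>a\<le>A. \<Sum>b\<le>B. (c (real A / 2 - real a, real B / 2 - real b)
        * (of_real (sqrt (real (A choose a))) * of_real (sqrt (real (B choose b))))) * hmono A a p * hmono B b q)" for c
    unfolding weights_eq sum_Times sum.reindex[OF inj_on_weights]
    by (auto simp: psi_eq mult_ac psi_tensor_def tensor_def intro!: ext sum.cong)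
  have "?Q c0"
  proof
    show "F = (\<lambda>z. \<Sum>j\<in>?W. c0 j * psi_tensor (real A / 2) (real B / 2) j z)"
      unfolding sum by (subst tensor_space_expand[OF F]) (auto simp: c0 intro!: ext sum.cong)
  qed (auto simp: c0_def)
  moreover have "c = c0" if "?Q c" for c
  proof
    fix j
    show "c j = c0 j"
    proof (cases "j \<in> ?W")
      case True
      then obtain a b where i: "a \<le> A" "b \<le> B" "j = (real A / 2 - real a, real B / 2 - real b)"
        by (auto simp: weights_eq)
      have "tcoeff A B F a b = c j * (of_real (sqrt (real (A choose a))) * of_real (sqrt (real (B choose b))))"
        using tcoeff_sum[OF i(1,2)] that unfolding sum i(3) by simp
      then show ?thesis
        using i by (simp add: c0)
    next
      case False
      then have "c0 j = 0" by (cases j) (auto simp: c0_def)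
      moreover have "c j = 0" using that False by (intro conjunct1[OF that, rule_format])
      ultimately show ?thesis by simp
    qed
  qed
  ultimately have "coord ?W (psi_tensor (real A / 2) (real B / 2)) F = c0"
    unfolding coord_def by (rule the_equality)
  then show ?thesis using c0 assms by simp
qed

lemma sqrt_binomial_mult: "complex_of_real (sqrt (real (n choose i))) * of_real (sqrt (real (n choose i)))
    = of_nat (n choose i)"
  unfolding of_real_mult[symmetric] by simp

lemma inner_V_eq:
  assumes "P \<in> hpolys (real N / 2)" "Q \<in> hpolys (real N / 2)"
  shows "inner_V (real N / 2) P Q = (\<Sum>i\<le>N. hcoeff N P i * cnj (hcoeff N Q i) / of_nat (N choose i))"
  unfolding inner_V_def basis_inner_def weights_eq sum.reindex[OF inj_on_weights]
  unfolding weights_eq[symmetric]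
  by (intro sum.cong refl) (simp add: assms coord_psi sqrt_binomial_mult)

lemma inner_tensor_eq:
  assumes "F \<in> tensor_space (real A / 2) (real B / 2)" "G \<in> tensor_space (real A / 2) (real B / 2)"
  shows "inner_tensor (real A / 2) (real B / 2) F G
    = (\<Sum>a\<le>A. \<Sum>b\<le>B. tcoeff A B F a b * cnj (tcoeff A B G a b) / of_nat ((A choose a) * (B choose b)))"
proof -
  have "complex_of_real (sqrt (real (A choose a))) * of_real (sqrt (real (B choose b))) *
      (of_real (sqrt (real (A choose a))) * of_real (sqrt (real (B choose b)))) = of_nat ((A choose a) * (B choose b))"
     for a b
    unfolding of_nat_mult sqrt_binomial_mult[symmetric] by (simp only: mult_ac)
  then show ?thesis
    unfolding inner_tensor_def basis_inner_def weights_eq sum_Times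
      sum.reindex[OF inj_on_weights] o_def
    unfolding weights_eq[symmetric]
    by (intro sum.cong refl) (simp add: assms coord_psi_tensor)
qed

section \<open>The infinitesimal form of equivariance\<close>

text \<open>
  The action of the matrix with rows \<open>(p, q)\<close>, \<open>(r, s)\<close> of \<open>gl(2)\<close> on the monomials
  \<open>g e = x^e y^(N - e)\<close>, with \<open>g\<close> left open: it is the derivative at the identity of the substitution
  action.  The entry \<open>q\<close> belongs to \<open>x d/dy\<close>, the entry \<open>r\<close> to \<open>y d/dx\<close>.
\<close>

definition basis_deriv :: "complex \<Rightarrow> complex \<Rightarrow> complex \<Rightarrow> complex \<Rightarrow> nat \<Rightarrow> (nat \<Rightarrow> complex) \<Rightarrow> nat \<Rightarrow> complex" where
  "basis_deriv p q r s N g e = (of_nat e * p + of_nat (N - e) * s) * g e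
     + of_nat e * r * g (e - 1) + of_nat (N - e) * q * g (e + 1)"

text \<open>
  The same action on the coefficient sequence \<open>c\<close> of a form, that is, the transpose of
  \<open>basis_deriv\<close>.
\<close>

definition coeff_deriv :: "complex \<Rightarrow> complex \<Rightarrow> complex \<Rightarrow> complex \<Rightarrow> nat \<Rightarrow> (nat \<Rightarrow> complex) \<Rightarrow> nat \<Rightarrow> complex" where
  "coeff_deriv p q r s N c e = (of_nat e * p + of_nat (N - e) * s) * c e
     + (if e < N then of_nat (e + 1) * r * c (e + 1) else 0)
     + (if 0 < e then of_nat (N - e + 1) * q * c (e - 1) else 0)"

lemma sum_basis_deriv: "(\<Sum>e\<le>N. c e * basis_deriv p q r s N g e) = (\<Sum>e\<le>N. coeff_deriv p q r s N c e * g e)"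
proof -
  have 1: "(\<Sum>e\<le>N. c e * (of_nat e * r * g (e - 1))) = (\<Sum>e\<le>N. (if e < N then of_nat (e + 1) * r * c (e + 1) else 0) * g e)"
  proof -
    have "(\<Sum>e\<le>N. c e * (of_nat e * r * g (e - 1))) = (\<Sum>e<N. c (Suc e) * (of_nat (Suc e) * r * g e))"
      by (subst sum.atMost_shift) simp
    also have "\<dots> = (\<Sum>e\<le>N. (if e < N then of_nat (e + 1) * r * c (e + 1) else 0) * g e)"
      by (rule sum.mono_neutral_cong_left) auto
    finally show ?thesis .
  qed
  have 2: "(\<Sum>e\<le>N. c e * (of_nat (N - e) * q * g (e + 1))) = (\<Sum>e\<le>N. (if 0 < e then of_nat (N - e + 1) * q * c (e - 1) else 0) * g e)"
  proof -
    have "(\<Sum>e\<le>N. (if 0 < e then of_nat (N - e + 1) * q * c (e - 1) else 0) * g e)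
      = (\<Sum>e<N. of_nat (N - Suc e + 1) * q * c e * g (Suc e))"
      by (subst sum.atMost_shift) simp
    also have "\<dots> = (\<Sum>e<N. c e * (of_nat (N - e) * q * g (e + 1)))"
      by (intro sum.cong refl) (simp add: Suc_diff_Suc mult_ac del: of_nat_Suc of_nat_diff)
    also have "\<dots> = (\<Sum>e\<le>N. c e * (of_nat (N - e) * q * g (e + 1)))"
      by (rule sum.mono_neutral_left) auto
    finally show ?thesis by simp
  qed
  show ?thesis
    unfolding basis_deriv_def coeff_deriv_def distrib_left distrib_right sum.distrib
    using 1 2 by (simp add: algebra_simps)
qed

abbreviation mat2 :: "complex \<Rightarrow> complex \<Rightarrow> complex \<Rightarrow> complex \<Rightarrow> complex^2^2" where
  "mat2 p q r s \<equiv> vector [vector [p, q], vector [r, s]]"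

lemma subst_mat2: "subst (mat2 p q r s) (x, y) = (p * x + r * y, q * x + s * y)"
  by (simp add: subst_def)

lemma mat2_in_SU2:
  assumes "p * cnj p + q * cnj q = 1" "p * cnj r + q * cnj s = 0" "r * cnj p + s * cnj q = 0"
    "r * cnj r + s * cnj s = 1" "p * s - q * r = 1"
  shows "mat2 p q r s \<in> SU2"
  using assms
  by (simp add: SU2_def vec_eq_iff forall_2 matrix_matrix_mult_def sum_2 det_2 map_matrix_def transpose_def mat_def)

text \<open>
  The curve with entries \<open>a, b, c, d\<close> passes through the identity at \<open>0\<close> with tangent vector
  \<open>p, q, r, s\<close>.
\<close>

lemma hmono_subst_deriv:
  assumes a: "(a has_field_derivative p) (at 0)" "a 0 = 1" and b: "(b has_field_derivative q) (at 0)" "b 0 = 0"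
    and c: "(c has_field_derivative r) (at 0)" "c 0 = 0" and d: "(d has_field_derivative s) (at 0)" "d 0 = 1"
    and i: "i \<le> N"
  shows "((\<lambda>z. hmono N i (subst (mat2 (a z) (b z) (c z) (d z)) v)) has_field_derivative
      basis_deriv p q r s N (\<lambda>e. hmono N e v) i) (at 0)"
proof -
  obtain x y where v: "v = (x, y)" by force
  have "((\<lambda>z. (a z * x + c z * y) ^ i * (b z * x + d z * y) ^ (N - i)) has_field_derivative
      (of_nat i * ((p * x + r * y) * x ^ (i - 1)) * y ^ (N - i)
        + of_nat (N - i) * ((q * x + s * y) * y ^ (N - i - 1)) * x ^ i)) (at 0)"
    using a b c d by (auto intro!: derivative_eq_intros)
  also have "of_nat i * ((p * x + r * y) * x ^ (i - 1)) * y ^ (N - i)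
        + of_nat (N - i) * ((q * x + s * y) * y ^ (N - i - 1)) * x ^ i
      = basis_deriv p q r s N (\<lambda>e. hmono N e v) i"
  proof -
    have "of_nat i * ((p * x + r * y) * x ^ (i - 1)) * y ^ (N - i)
       = of_nat i * p * (x ^ i * y ^ (N - i)) + of_nat i * r * (x ^ (i - 1) * y ^ (N - (i - 1)))"
    proof (cases i)
      case (Suc n)
      then have "N - n = Suc (N - i)" using i by simp
      then have "y ^ (N - n) = y * y ^ (N - i)" by simp
      with Suc show ?thesis by (simp add: algebra_simps)
    qed simp
    moreover have "of_nat (N - i) * ((q * x + s * y) * y ^ (N - i - 1)) * x ^ i
       = of_nat (N - i) * s * (x ^ i * y ^ (N - i)) + of_nat (N - i) * q * (x ^ (i + 1) * y ^ (N - (i + 1)))"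
    proof (cases "N - i")
      case (Suc n)
      then have "N - (i + 1) = n" by simp
      with Suc show ?thesis by (simp add: algebra_simps)
    qed simp
    ultimately show ?thesis
      by (simp add: basis_deriv_def hmono_def v algebra_simps)
  qed
  finally show ?thesis
    by (simp add: v hmono_def subst_mat2)
qed

text \<open>
  The part of the definition of the Clebsch--Gordan embedding that remains when the normalisation is
  forgotten.
\<close>

definition intertwiner :: "nat \<Rightarrow> nat \<Rightarrow> nat \<Rightarrow>
    ((complex \<times> complex \<Rightarrow> complex) \<Rightarrow> (complex \<times> complex) \<times> (complex \<times> complex) \<Rightarrow> complex) \<Rightarrow> bool" where
  "intertwiner A B D \<Phi> \<longleftrightarrow>
     \<Phi> \<in> hpolys (real D / 2) \<rightarrow> tensor_space (real A / 2) (real B / 2) \<and>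
     (\<forall>P \<in> hpolys (real D / 2). \<forall>Q \<in> hpolys (real D / 2). \<forall>s t.
        \<Phi> (\<lambda>p. s * P p + t * Q p) = (\<lambda>z. s * \<Phi> P z + t * \<Phi> Q z)) \<and>
     (\<forall>g \<in> SU2. \<forall>P \<in> hpolys (real D / 2). \<Phi> (act g P) = tensor_act g (\<Phi> P))"

text \<open>
  The entry of the matrix of \<open>\<Phi>\<close>, in monomial bases, at source index \<open>i\<close> and target index \<open>(a, b)\<close>.
\<close>

definition matrix_coeff where
  "matrix_coeff A B D \<Phi> i a b = tcoeff A B (\<Phi> (hmono D i)) a b"

lemma tcoeff_lincomb: "tcoeff A B (\<lambda>z. \<Sum>i\<in>I. c i * F i z) a b = (\<Sum>i\<in>I. c i * tcoeff A B (F i) a b)"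
  by (simp add: tcoeff_def dft_coeff_sum dft_coeff_cmult)

lemma intertwiner_lincomb:
  assumes \<Phi>: "intertwiner A B D \<Phi>" and "finite I" "\<And>i. i \<in> I \<Longrightarrow> f i \<in> hpolys (real D / 2)"
  shows "\<Phi> (\<lambda>p. \<Sum>i\<in>I. c i * f i p) = (\<lambda>z. \<Sum>i\<in>I. c i * \<Phi> (f i) z)"
  using assms(2,3)
proof (induction I rule: finite_induct)
  case empty
  have lin: "\<Phi> (\<lambda>p. s * P p + t * P p) = (\<lambda>z. s * \<Phi> P z + t * \<Phi> P z)" if "P \<in> hpolys (real D / 2)" for P s t
    using \<Phi> that unfolding intertwiner_def by blast
  have "hmono D 0 \<in> hpolys (real D / 2)" by (rule hmono_in_hpolys) simp
  \<comment> \<open>The zero polynomial is a combination with coefficients \<open>0\<close> of any element of \<open>V\<^sub>l\<close>.\<close>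
  from lin[OF this, of 0 0] show ?case by simp
next
  case (insert j I)
  have lin: "\<Phi> (\<lambda>p. s * P p + t * Q p) = (\<lambda>z. s * \<Phi> P z + t * \<Phi> Q z)"
    if "P \<in> hpolys (real D / 2)" "Q \<in> hpolys (real D / 2)" for P Q s t
    using \<Phi> that unfolding intertwiner_def by blast
  have "(\<lambda>p. \<Sum>i\<in>I. c i * f i p) \<in> hpolys (real D / 2)"
    using insert by (intro hpolys_sum) auto
  with insert lin[of "f j" "\<lambda>p. \<Sum>i\<in>I. c i * f i p" "c j" 1] show ?case by simp
qed

lemma intertwiner_tcoeff:
  assumes \<Phi>: "intertwiner A B D \<Phi>" and P: "P \<in> hpolys (real D / 2)"
  shows "tcoeff A B (\<Phi> P) a b = (\<Sum>i\<le>D. hcoeff D P i * matrix_coeff A B D \<Phi> i a b)"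
  by (subst hpolys_expand[OF P], subst intertwiner_lincomb[OF \<Phi>])
     (auto simp: hmono_in_hpolys tcoeff_lincomb matrix_coeff_def)

text \<open>
  Equivariance under a curve in \<open>SU(2)\<close> through the identity is an identity between two functions of
  the real curve parameter.  Both are finite combinations of products of the matrix entries, and comparing
  their derivatives at \<open>0\<close> gives the relation for the tangent vector.  The curve is taken
  with complex parameter for the sake of the rules for complex derivatives; it lies in \<open>SU(2)\<close> for real
  parameters only.
\<close>

lemma intertwiner_deriv:
  assumes \<Phi>: "intertwiner A B D \<Phi>"
    and a: "(a has_field_derivative p) (at 0)" "a 0 = 1" and b: "(b has_field_derivative q) (at 0)" "b 0 = 0"
    and c: "(c has_field_derivative r) (at 0)" "c 0 = 0" and d: "(d has_field_derivative s) (at 0)" "d 0 = 1"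
    and SU2: "\<And>t :: real. mat2 (a t) (b t) (c t) (d t) \<in> SU2"
    and i: "i \<le> D" and x: "x \<le> A" and y: "y \<le> B"
  shows "basis_deriv p q r s D (\<lambda>e. matrix_coeff A B D \<Phi> e x y) i
    = coeff_deriv p q r s A (\<lambda>x'. matrix_coeff A B D \<Phi> i x' y) x + coeff_deriv p q r s B (\<lambda>y'. matrix_coeff A B D \<Phi> i x y') y"
proof -
  let ?g = "\<lambda>z. mat2 (a z) (b z) (c z) (d z)" and ?T = "matrix_coeff A B D \<Phi>"
  define f where "f z = (\<Sum>e\<le>D. hcoeff D (act (?g z) (hmono D i)) e * ?T e x y)" for z
  define h where "h z = tcoeff A B (tensor_act (?g z) (\<Phi> (hmono D i))) x y" for z
  note deriv = hmono_subst_deriv[OF a b c d]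
  have F: "\<Phi> (hmono D i) \<in> tensor_space (real A / 2) (real B / 2)"
    using \<Phi> i hmono_in_hpolys unfolding intertwiner_def by blast
  have fh: "f (of_real t) = h (of_real t)" for t :: real
  proof -
    have "tensor_act (?g t) (\<Phi> (hmono D i)) = \<Phi> (act (?g t) (hmono D i))"
      using \<Phi> SU2 hmono_in_hpolys[OF i] unfolding intertwiner_def by auto
    then show ?thesis
      unfolding f_def h_def by (simp add: intertwiner_tcoeff[OF \<Phi> act_hmono_in_hpolys[OF i]])
  qed
  \<comment> \<open>The coefficients of the monomial with index \<open>i\<close> itself.\<close>
  define \<delta> where "\<delta> e = (of_bool (e = i) :: complex)" for e
  have basis_deriv_eq: "basis_deriv p q r s D g i = (\<Sum>e\<le>D. coeff_deriv p q r s D \<delta> e * g e)" for g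
    using sum_basis_deriv[of \<delta> p q r s D g] i by (simp add: \<delta>_def)
  have "((\<lambda>z. hcoeff D (act (?g z) (hmono D i)) e) has_field_derivative
      coeff_deriv p q r s D \<delta> e) (at 0)" if "e \<le> D" for e
  proof -
    have "coeff_deriv p q r s D \<delta> e = dft_coeff D e (\<lambda>t. basis_deriv p q r s D (\<lambda>e. hmono D e (t, 1)) i)"
      unfolding basis_deriv_eq using hcoeff_sum[OF that] by (simp add: hcoeff_def)
    then show ?thesis
      unfolding hcoeff_def act_def by (simp only:) (intro dft_coeff_deriv deriv i)
  qed
  then have "(f has_field_derivative (\<Sum>e\<le>D. coeff_deriv p q r s D \<delta> e * ?T e x y)) (at 0)"
    unfolding f_def by (intro DERIV_sum DERIV_cmult_right) auto
  then have f': "(f has_field_derivative basis_deriv p q r s D (\<lambda>e. ?T e x y) i) (at 0)"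
    unfolding basis_deriv_eq .
  let ?L = "\<lambda>x y. coeff_deriv p q r s A (\<lambda>x'. ?T i x' y) x + coeff_deriv p q r s B (\<lambda>y'. ?T i x y') y"
  have expand: "tensor_act (?g z) (\<Phi> (hmono D i)) (v, w)
      = (\<Sum>x\<le>A. \<Sum>y\<le>B. ?T i x y * (hmono A x (subst (?g z) v) * hmono B y (subst (?g z) w)))" for z v w
    unfolding tensor_act_def matrix_coeff_def
    by (subst tensor_space_expand[OF F]) (simp add: mult.assoc)
  have deriv_tensor: "((\<lambda>z. tensor_act (?g z) (\<Phi> (hmono D i)) (v, w)) has_field_derivative
      (\<Sum>x\<le>A. \<Sum>y\<le>B. ?L x y * hmono A x v * hmono B y w)) (at 0)" for v w
  proof -
    have g0: "subst (?g 0) v = v" for v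
      using a b c d by (cases v) (simp add: subst_mat2)
    have "((\<lambda>z. tensor_act (?g z) (\<Phi> (hmono D i)) (v, w)) has_field_derivative
      (\<Sum>x\<le>A. \<Sum>y\<le>B. ?T i x y * (basis_deriv p q r s A (\<lambda>e. hmono A e v) x * hmono B y w
         + basis_deriv p q r s B (\<lambda>e. hmono B e w) y * hmono A x v))) (at 0)"
      unfolding expand
    proof (intro DERIV_sum DERIV_cmult)
      fix x y assume "x \<in> {..A}" "y \<in> {..B}"
      then show "((\<lambda>z. hmono A x (subst (?g z) v) * hmono B y (subst (?g z) w)) has_field_derivative
        (basis_deriv p q r s A (\<lambda>e. hmono A e v) x * hmono B y w
         + basis_deriv p q r s B (\<lambda>e. hmono B e w) y * hmono A x v)) (at 0)"
        using DERIV_mult[OF deriv[of x A v] deriv[of y B w]] by (simp add: g0)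
    qed
    also have "(\<Sum>x\<le>A. \<Sum>y\<le>B. ?T i x y * (basis_deriv p q r s A (\<lambda>e. hmono A e v) x * hmono B y w
         + basis_deriv p q r s B (\<lambda>e. hmono B e w) y * hmono A x v))
       = (\<Sum>y\<le>B. (\<Sum>x\<le>A. ?T i x y * basis_deriv p q r s A (\<lambda>e. hmono A e v) x) * hmono B y w)
        + (\<Sum>x\<le>A. (\<Sum>y\<le>B. ?T i x y * basis_deriv p q r s B (\<lambda>e. hmono B e w) y) * hmono A x v)"
      unfolding distrib_left sum.distrib sum_distrib_right
      by (intro arg_cong2[of _ _ _ _ plus], subst sum.swap) (simp_all only: mult.assoc)
    also have "\<dots> = (\<Sum>y\<le>B. (\<Sum>x\<le>A. coeff_deriv p q r s A (\<lambda>x'. ?T i x' y) x * hmono A x v) * hmono B y w)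
        + (\<Sum>x\<le>A. (\<Sum>y\<le>B. coeff_deriv p q r s B (\<lambda>y'. ?T i x y') y * hmono B y w) * hmono A x v)"
      by (simp only: sum_basis_deriv)
    also have "\<dots> = (\<Sum>x\<le>A. \<Sum>y\<le>B. ?L x y * hmono A x v * hmono B y w)"
      unfolding distrib_right sum.distrib sum_distrib_right
      by (intro arg_cong2[of _ _ _ _ plus], subst sum.swap) (simp_all only: mult_ac)
    finally show ?thesis .
  qed
  have h': "(h has_field_derivative ?L x y) (at 0)"
  proof -
    have "?L x y = dft_coeff A x (\<lambda>u. dft_coeff B y (\<lambda>t.
        \<Sum>x\<le>A. \<Sum>y\<le>B. ?L x y * hmono A x (u, 1) * hmono B y (t, 1)))"
      using tcoeff_sum[OF x y, of ?L] unfolding tcoeff_def by simp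
    then show ?thesis
      unfolding h_def tcoeff_def by (simp only:) (intro dft_coeff_deriv deriv_tensor)
  qed
  have "((\<lambda>t. f (of_real t)) has_vector_derivative basis_deriv p q r s D (\<lambda>e. ?T e x y) i) (at (0::real))"
    using has_vector_derivative_real_field[of f _ 0 UNIV] f' by simp
  moreover have "((\<lambda>t. f (of_real t)) has_vector_derivative ?L x y) (at (0::real))"
    unfolding fh using has_vector_derivative_real_field[of h _ 0 UNIV] h' by simp
  ultimately show ?thesis
    by (rule vector_derivative_unique_at)
qed

section \<open>Ladder relations, norms and uniqueness of intertwiners\<close>

text \<open>
  As operators on coefficients, \<open>lower\<close> is \<open>x d/dy\<close> and \<open>raise\<close> is \<open>y d/dx\<close>.  The highest weight is
  carried by \<open>y^N\<close>, in accordance with the indexing of the basis \<open>psi\<close>.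
\<close>

abbreviation lower :: "nat \<Rightarrow> (nat \<Rightarrow> complex) \<Rightarrow> nat \<Rightarrow> complex" where
  "lower \<equiv> coeff_deriv 0 1 0 0"

abbreviation raise :: "nat \<Rightarrow> (nat \<Rightarrow> complex) \<Rightarrow> nat \<Rightarrow> complex" where
  "raise \<equiv> coeff_deriv 0 0 1 0"

lemma raise_eq: "raise N c e = (if e < N then of_nat (e + 1) * c (e + 1) else 0)"
  by (auto simp: coeff_deriv_def)

lemma choose_Suc_ratio:
  "of_nat (Suc e) * of_nat (N choose Suc e) = (of_nat (N - e) * of_nat (N choose e) :: complex)"
  unfolding of_nat_mult[symmetric] by (simp only: binomial_absorption binomial_absorb_comp)

lemma cos_sin_unit: "complex_of_real (cos t) * complex_of_real (cos t) + complex_of_real (sin t) * complex_of_real (sin t) = 1"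
  unfolding of_real_mult[symmetric] of_real_add[symmetric] by (simp flip: power2_eq_square)

text \<open>
  The three curves used are the rotations, their conjugates by a diagonal matrix, and the diagonal torus.
  Their tangent vectors span the complexified Lie algebra \<open>sl(2)\<close>.
\<close>

lemma intertwiner_rotation:
  assumes \<Phi>: "intertwiner A B D \<Phi>" and i: "i \<le> D" and a: "a \<le> A" and b: "b \<le> B"
  defines "T \<equiv> matrix_coeff A B D \<Phi>"
  shows "basis_deriv 0 1 (-1) 0 D (\<lambda>e. T e a b) i = coeff_deriv 0 1 (-1) 0 A (\<lambda>a. T i a b) a + coeff_deriv 0 1 (-1) 0 B (\<lambda>b. T i a b) b"
  unfolding T_def
proof (rule intertwiner_deriv[OF \<Phi> _ _ _ _ _ _ _ _ _ i a b, where a = cos and b = sin and c = "\<lambda>z. - sin z" and d = cos])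
  fix t :: real
  show "mat2 (cos (of_real t)) (sin (of_real t)) (- sin (of_real t)) (cos (of_real t)) \<in> SU2"
    by (intro mat2_in_SU2) (use cos_sin_unit[of t] in \<open>simp_all add: cos_of_real sin_of_real add.commute\<close>)
qed (auto intro!: derivative_eq_intros)

lemma intertwiner_imaginary_rotation:
  assumes \<Phi>: "intertwiner A B D \<Phi>" and i: "i \<le> D" and a: "a \<le> A" and b: "b \<le> B"
  defines "T \<equiv> matrix_coeff A B D \<Phi>"
  shows "basis_deriv 0 \<i> \<i> 0 D (\<lambda>e. T e a b) i = coeff_deriv 0 \<i> \<i> 0 A (\<lambda>a. T i a b) a + coeff_deriv 0 \<i> \<i> 0 B (\<lambda>b. T i a b) b"
  unfolding T_def
proof (rule intertwiner_deriv[OF \<Phi> _ _ _ _ _ _ _ _ _ i a b, where a = cos and b = "\<lambda>z. \<i> * sin z" and c = "\<lambda>z. \<i> * sin z" and d = cos])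
  fix t :: real
  have "\<i> * complex_of_real (sin t) * (\<i> * complex_of_real (sin t)) = - (complex_of_real (sin t) * complex_of_real (sin t))"
    by (simp add: mult.assoc mult.left_commute[of "complex_of_real (sin t)" \<i>])
  then show "mat2 (cos (of_real t)) (\<i> * sin (of_real t)) (\<i> * sin (of_real t)) (cos (of_real t)) \<in> SU2"
    by (intro mat2_in_SU2) (use cos_sin_unit[of t] in \<open>simp_all add: cos_of_real sin_of_real add.commute\<close>)
qed (auto intro!: derivative_eq_intros)

lemma intertwiner_torus:
  assumes \<Phi>: "intertwiner A B D \<Phi>" and i: "i \<le> D" and a: "a \<le> A" and b: "b \<le> B"
  defines "T \<equiv> matrix_coeff A B D \<Phi>"
  shows "basis_deriv \<i> 0 0 (-\<i>) D (\<lambda>e. T e a b) i = coeff_deriv \<i> 0 0 (-\<i>) A (\<lambda>a. T i a b) a + coeff_deriv \<i> 0 0 (-\<i>) B (\<lambda>b. T i a b) b"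
  unfolding T_def
proof (rule intertwiner_deriv[OF \<Phi> _ _ _ _ _ _ _ _ _ i a b,
      where a = "\<lambda>z. exp (\<i> * z)" and b = "\<lambda>z. 0" and c = "\<lambda>z. 0" and d = "\<lambda>z. exp (- (\<i> * z))"])
  fix t :: real
  show "mat2 (exp (\<i> * of_real t)) 0 0 (exp (- (\<i> * of_real t))) \<in> SU2"
    by (intro mat2_in_SU2) (simp_all add: exp_cnj flip: exp_add)
qed (auto intro!: derivative_eq_intros)

text \<open>
  The rotations give the relation for \<open>lower - raise\<close>, the imaginary rotations the one for
  \<open>lower + raise\<close>.
\<close>

lemma intertwiner_ladder:
  assumes \<Phi>: "intertwiner A B D \<Phi>" and i: "i \<le> D" and a: "a \<le> A" and b: "b \<le> B"
  defines "T \<equiv> matrix_coeff A B D \<Phi>"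
  shows intertwiner_lower: "lower A (\<lambda>a. T i a b) a + lower B (\<lambda>b. T i a b) b = of_nat (D - i) * T (i + 1) a b"
    and intertwiner_raise: "raise A (\<lambda>a. T i a b) a + raise B (\<lambda>b. T i a b) b = of_nat i * T (i - 1) a b"
proof -
  let ?L = "lower A (\<lambda>a. T i a b) a + lower B (\<lambda>b. T i a b) b"
  let ?R = "raise A (\<lambda>a. T i a b) a + raise B (\<lambda>b. T i a b) b"
  have split1: "coeff_deriv 0 1 (-1) 0 N g e = lower N g e - raise N g e" for N g e
    by (simp add: coeff_deriv_def algebra_simps)
  have split2: "coeff_deriv 0 \<i> \<i> 0 N g e = \<i> * (lower N g e + raise N g e)" for N g e
    by (simp add: coeff_deriv_def distrib_left)
  have 1: "of_nat (D - i) * T (i + 1) a b - of_nat i * T (i - 1) a b = ?L - ?R"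
    using intertwiner_rotation[OF \<Phi> i a b] unfolding T_def[symmetric] split1
    by (simp add: basis_deriv_def)
  have "\<i> * (of_nat (D - i) * T (i + 1) a b + of_nat i * T (i - 1) a b) = \<i> * (?L + ?R)"
    using intertwiner_imaginary_rotation[OF \<Phi> i a b] unfolding T_def[symmetric] split2
    by (simp add: basis_deriv_def algebra_simps)
  then have 2: "of_nat (D - i) * T (i + 1) a b + of_nat i * T (i - 1) a b = ?L + ?R"
    by (subst (asm) mult_left_cancel) auto
  have "2 * ?L = 2 * (of_nat (D - i) * T (i + 1) a b)" using 1 2 by algebra
  then show "?L = of_nat (D - i) * T (i + 1) a b"
    by (rule mult_left_cancel[THEN iffD1, rotated]) simp
  have "2 * ?R = 2 * (of_nat i * T (i - 1) a b)" using 1 2 by algebra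
  then show "?R = of_nat i * T (i - 1) a b"
    by (rule mult_left_cancel[THEN iffD1, rotated]) simp
qed

text \<open>
  The torus acts diagonally on both sides, so a nonzero matrix entry forces the weights to agree.
\<close>

lemma intertwiner_weight:
  assumes \<Phi>: "intertwiner A B D \<Phi>" and AB: "A + B = D + 2 * k" and i: "i \<le> D" and a: "a \<le> A" and b: "b \<le> B"
    and nz: "matrix_coeff A B D \<Phi> i a b \<noteq> 0"
  shows "a + b = i + k"
proof -
  let ?T = "matrix_coeff A B D \<Phi> i a b"
  have "\<i> * (of_nat i - of_nat (D - i)) * ?T = \<i> * (of_nat a - of_nat (A - a) + of_nat b - of_nat (B - b)) * ?T"
    using intertwiner_torus[OF \<Phi> i a b] by (simp add: basis_deriv_def coeff_deriv_def algebra_simps del: of_nat_diff)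
  then have "of_nat i - of_nat (D - i) = (of_nat a - of_nat (A - a) + of_nat b - of_nat (B - b) :: complex)"
    using nz by simp
  then have "of_nat i + of_nat (A - a) + of_nat (B - b) = (of_nat a + of_nat b + of_nat (D - i) :: complex)"
    by (simp add: algebra_simps del: of_nat_diff)
  then have "i + (A - a) + (B - b) = a + b + (D - i)"
    by (simp only: of_nat_add[symmetric] of_nat_eq_iff)
  then show ?thesis using i a b AB by linarith
qed

text \<open>
  The scalar product of the tensor product in monomial coefficients: the monomial with index \<open>(a, b)\<close> has
  squared norm \<open>1 / ((A choose a) (B choose b))\<close>.
\<close>

definition coeff_inner :: "nat \<Rightarrow> nat \<Rightarrow> (nat \<Rightarrow> nat \<Rightarrow> complex) \<Rightarrow> (nat \<Rightarrow> nat \<Rightarrow> complex) \<Rightarrow> complex" where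
  "coeff_inner A B c d = (\<Sum>a\<le>A. \<Sum>b\<le>B. c a b * cnj (d a b) / of_nat ((A choose a) * (B choose b)))"

text \<open>
  \<open>x d/dy\<close> and \<open>y d/dx\<close> are adjoint for the scalar product on \<open>V\<^sub>l\<close>; this is where the binomial
  weights of the basis \<open>psi\<close> enter.
\<close>

lemma lower_raise_adjoint:
  "(\<Sum>e\<le>N. lower N c e * cnj (d e) / of_nat (N choose e)) = (\<Sum>e\<le>N. c e * cnj (raise N d e) / of_nat (N choose e))"
proof -
  define g where "g e = cnj (d e) / of_nat (N choose e)" for e
  have g: "basis_deriv 0 1 0 0 N g e = cnj (raise N d e) / of_nat (N choose e)" if "e \<le> N" for e
  proof (cases "e < N")
    case True
    have "of_nat (Suc e) * of_nat (N choose Suc e) = (of_nat (N - e) * of_nat (N choose e) :: complex)"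
      by (rule choose_Suc_ratio)
    moreover have "of_nat (N choose Suc e) \<noteq> (0::complex)" "of_nat (N choose e) \<noteq> (0::complex)"
      using True by (auto simp: binomial_eq_0_iff)
    ultimately have "of_nat (N - e) / of_nat (N choose Suc e) = (of_nat (Suc e) / of_nat (N choose e) :: complex)"
      by (simp add: divide_simps mult.commute del: of_nat_Suc of_nat_diff)
    then have "of_nat (N - e) / of_nat (N choose Suc e) * cnj (d (Suc e)) = of_nat (Suc e) / of_nat (N choose e) * cnj (d (Suc e))"
      by simp
    then show ?thesis
      using True by (simp add: basis_deriv_def coeff_deriv_def g_def del: of_nat_Suc of_nat_diff)
  qed (use that in \<open>simp add: basis_deriv_def coeff_deriv_def\<close>)
  have "(\<Sum>e\<le>N. lower N c e * cnj (d e) / of_nat (N choose e)) = (\<Sum>e\<le>N. c e * basis_deriv 0 1 0 0 N g e)"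
    unfolding sum_basis_deriv by (simp add: g_def)
  also have "\<dots> = (\<Sum>e\<le>N. c e * cnj (raise N d e) / of_nat (N choose e))"
    by (intro sum.cong refl) (simp add: g)
  finally show ?thesis .
qed

lemma coeff_inner_lower:
  "coeff_inner A B (\<lambda>a b. lower A (\<lambda>a. c a b) a + lower B (c a) b) d
    = coeff_inner A B c (\<lambda>a b. raise A (\<lambda>a. d a b) a + raise B (d a) b)"
proof -
  have split: "coeff_inner A B (\<lambda>a b. f a b + g a b) h = coeff_inner A B f h + coeff_inner A B g h"
    "coeff_inner A B h (\<lambda>a b. f a b + g a b) = coeff_inner A B h f + coeff_inner A B h g" for f g h
    by (simp_all add: coeff_inner_def distrib_left distrib_right add_divide_distrib sum.distrib)
  have swap: "coeff_inner A B f g = (\<Sum>b\<le>B. (\<Sum>a\<le>A. f a b * cnj (g a b) / of_nat (A choose a)) / of_nat (B choose b))" for f g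
    unfolding coeff_inner_def sum_divide_distrib by (subst sum.swap) simp
  have noswap: "coeff_inner A B f g = (\<Sum>a\<le>A. (\<Sum>b\<le>B. f a b * cnj (g a b) / of_nat (B choose b)) / of_nat (A choose a))" for f g
    unfolding coeff_inner_def sum_divide_distrib by (simp add: mult.commute)
  have "coeff_inner A B (\<lambda>a b. lower A (\<lambda>a. c a b) a) d = coeff_inner A B c (\<lambda>a b. raise A (\<lambda>a. d a b) a)"
    unfolding swap lower_raise_adjoint ..
  moreover have "coeff_inner A B (\<lambda>a b. lower B (c a) b) d = coeff_inner A B c (\<lambda>a b. raise B (d a) b)"
    unfolding noswap lower_raise_adjoint ..
  ultimately show ?thesis unfolding split by simp
qed

lemma coeff_inner_cong: "(\<And>a b. a \<le> A \<Longrightarrow> b \<le> B \<Longrightarrow> c a b = c' a b) \<Longrightarrow> (\<And>a b. a \<le> A \<Longrightarrow> b \<le> B \<Longrightarrow> d a b = d' a b)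
   \<Longrightarrow> coeff_inner A B c d = coeff_inner A B c' d'"
  unfolding coeff_inner_def by (intro sum.cong refl) auto

lemma coeff_inner_cmult: "coeff_inner A B (\<lambda>a b. s * c a b) d = s * coeff_inner A B c d" "coeff_inner A B c (\<lambda>a b. s * d a b) = cnj s * coeff_inner A B c d"
  by (simp_all add: coeff_inner_def sum_distrib_left mult_ac)

lemma coeff_inner_sum_left: "coeff_inner A B (\<lambda>a b. \<Sum>i\<in>I. s i * c i a b) d = (\<Sum>i\<in>I. s i * coeff_inner A B (c i) d)"
proof -
  have "coeff_inner A B (\<lambda>a b. \<Sum>i\<in>I. s i * c i a b) d
      = (\<Sum>a\<le>A. \<Sum>b\<le>B. \<Sum>i\<in>I. s i * (c i a b * cnj (d a b) / of_nat ((A choose a) * (B choose b))))"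
    unfolding coeff_inner_def sum_distrib_right sum_divide_distrib by (simp only: mult.assoc times_divide_eq_right)
  also have "\<dots> = (\<Sum>a\<le>A. \<Sum>i\<in>I. \<Sum>b\<le>B. s i * (c i a b * cnj (d a b) / of_nat ((A choose a) * (B choose b))))"
    by (intro sum.cong refl sum.swap)
  also have "\<dots> = (\<Sum>i\<in>I. \<Sum>a\<le>A. \<Sum>b\<le>B. s i * (c i a b * cnj (d a b) / of_nat ((A choose a) * (B choose b))))"
    by (rule sum.swap)
  finally show ?thesis unfolding coeff_inner_def sum_distrib_left .
qed

lemma coeff_inner_commute: "coeff_inner A B c d = cnj (coeff_inner A B d c)"
  by (simp add: coeff_inner_def cnj_sum mult.commute)

lemma coeff_inner_sum_right: "coeff_inner A B d (\<lambda>a b. \<Sum>i\<in>I. s i * c i a b) = (\<Sum>i\<in>I. cnj (s i) * coeff_inner A B d (c i))"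
  by (subst coeff_inner_commute, subst coeff_inner_sum_left) (simp add: cnj_sum coeff_inner_commute[of A B d])

text \<open>
  Induction along the ladder.  With \<open>T i\<close> the image of \<open>x^i y^(D - i)\<close>, adjointness gives
  \<open>(D - i) |T (i + 1)|^2 = (i + 1) |T i|^2\<close>, which is also the recursion of
  \<open>1 / (D choose i)\<close>.
\<close>

lemma intertwiner_norm:
  assumes \<Phi>: "intertwiner A B D \<Phi>" and "i \<le> D"
  defines "T \<equiv> matrix_coeff A B D \<Phi>"
  shows "coeff_inner A B (T i) (T i) = coeff_inner A B (T 0) (T 0) / of_nat (D choose i)"
  using \<open>i \<le> D\<close>
proof (induction i)
  case (Suc i)
  have "of_nat (D - i) * coeff_inner A B (T (Suc i)) (T (Suc i)) = coeff_inner A B (\<lambda>a b. of_nat (D - i) * T (i + 1) a b) (T (Suc i))"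
    by (simp add: coeff_inner_cmult)
  also have "\<dots> = coeff_inner A B (\<lambda>a b. lower A (\<lambda>a. T i a b) a + lower B (T i a) b) (T (Suc i))"
    using intertwiner_lower[OF \<Phi>] Suc.prems by (intro coeff_inner_cong) (auto simp: T_def)
  also have "\<dots> = coeff_inner A B (T i) (\<lambda>a b. raise A (\<lambda>a. T (Suc i) a b) a + raise B (T (Suc i) a) b)"
    by (rule coeff_inner_lower)
  also have "\<dots> = coeff_inner A B (T i) (\<lambda>a b. of_nat (Suc i) * T i a b)"
    using intertwiner_raise[OF \<Phi> Suc.prems] by (intro coeff_inner_cong) (auto simp: T_def)
  also have "\<dots> = of_nat (Suc i) * coeff_inner A B (T 0) (T 0) / of_nat (D choose i)"
    using Suc by (simp add: coeff_inner_cmult)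
  finally have *: "of_nat (D - i) * coeff_inner A B (T (Suc i)) (T (Suc i)) = of_nat (Suc i) * coeff_inner A B (T 0) (T 0) / of_nat (D choose i)" .
  have bin: "of_nat (Suc i) * of_nat (D choose Suc i) = (of_nat (D - i) * of_nat (D choose i) :: complex)"
    by (rule choose_Suc_ratio)
  have nz: "of_nat (D choose Suc i) \<noteq> (0::complex)" "of_nat (D choose i) \<noteq> (0::complex)" "of_nat (D - i) \<noteq> (0::complex)"
    using Suc.prems by (auto simp: binomial_eq_0_iff simp del: of_nat_diff)
  have "of_nat (D - i) * of_nat (D choose i) * (of_nat (D choose Suc i) * coeff_inner A B (T (Suc i)) (T (Suc i)))
     = of_nat (D choose Suc i) * of_nat (D choose i) * (of_nat (D - i) * coeff_inner A B (T (Suc i)) (T (Suc i)))"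
    by (simp only: mult_ac)
  also have "\<dots> = of_nat (Suc i) * of_nat (D choose Suc i) * coeff_inner A B (T 0) (T 0)"
    unfolding * using nz by (simp del: of_nat_Suc of_nat_diff)
  also have "\<dots> = of_nat (D - i) * of_nat (D choose i) * coeff_inner A B (T 0) (T 0)"
    unfolding bin ..
  finally have "of_nat (D choose Suc i) * coeff_inner A B (T (Suc i)) (T (Suc i)) = coeff_inner A B (T 0) (T 0)"
    using nz by (simp del: of_nat_diff)
  then show ?case using nz by (simp add: nonzero_eq_divide_eq mult.commute)
qed simp

text \<open>
  Images of different monomials have different weights, hence disjoint supports.
\<close>

lemma intertwiner_orthogonal:
  assumes \<Phi>: "intertwiner A B D \<Phi>" and AB: "A + B = D + 2 * k" and "i \<le> D" "j \<le> D" "i \<noteq> j"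
  defines "T \<equiv> matrix_coeff A B D \<Phi>"
  shows "coeff_inner A B (T i) (T j) = 0"
proof -
  have "T i a b * cnj (T j a b) = 0" if "a \<le> A" "b \<le> B" for a b
  proof (rule ccontr)
    assume "T i a b * cnj (T j a b) \<noteq> 0"
    then have "T i a b \<noteq> 0" "T j a b \<noteq> 0" by auto
    then have "a + b = i + k" "a + b = j + k"
      using intertwiner_weight[OF \<Phi> AB] assms(3,4) that unfolding T_def by blast+
    with \<open>i \<noteq> j\<close> show False by simp
  qed
  then show ?thesis unfolding coeff_inner_def by (auto intro!: sum.neutral)
qed

text \<open>
  Schur's lemma for the invariant scalar product: an intertwiner is isometric up to a constant, the
  squared norm of the image of \<open>y^D\<close>.
\<close>

lemma intertwiner_inner:
  assumes \<Phi>: "intertwiner A B D \<Phi>" and AB: "A + B = D + 2 * k"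
    and P: "P \<in> hpolys (real D / 2)" and Q: "Q \<in> hpolys (real D / 2)"
  shows "inner_tensor (real A / 2) (real B / 2) (\<Phi> P) (\<Phi> Q)
    = coeff_inner A B (matrix_coeff A B D \<Phi> 0) (matrix_coeff A B D \<Phi> 0) * inner_V (real D / 2) P Q"
proof -
  let ?T = "matrix_coeff A B D \<Phi>"
  have mem: "\<Phi> P \<in> tensor_space (real A / 2) (real B / 2)" "\<Phi> Q \<in> tensor_space (real A / 2) (real B / 2)"
    using \<Phi> P Q unfolding intertwiner_def by auto
  have "inner_tensor (real A / 2) (real B / 2) (\<Phi> P) (\<Phi> Q) = coeff_inner A B
     (\<lambda>a b. \<Sum>i\<le>D. hcoeff D P i * ?T i a b) (\<lambda>a b. \<Sum>j\<le>D. hcoeff D Q j * ?T j a b)"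
    unfolding inner_tensor_eq[OF mem] coeff_inner_def
      intertwiner_tcoeff[OF \<Phi> P] intertwiner_tcoeff[OF \<Phi> Q] ..
  also have "\<dots> = (\<Sum>i\<le>D. hcoeff D P i * (\<Sum>j\<le>D. cnj (hcoeff D Q j) * coeff_inner A B (?T i) (?T j)))"
    unfolding coeff_inner_sum_left coeff_inner_sum_right ..
  also have "\<dots> = (\<Sum>i\<le>D. hcoeff D P i * (\<Sum>j\<le>D. if j = i then cnj (hcoeff D Q i) * (coeff_inner A B (?T 0) (?T 0) / of_nat (D choose i)) else 0))"
  proof (intro sum.cong refl arg_cong2[of _ _ _ _ times])
    fix i j assume ij: "i \<in> {..D}" "j \<in> {..D}"
    show "cnj (hcoeff D Q j) * coeff_inner A B (?T i) (?T j)
      = (if j = i then cnj (hcoeff D Q i) * (coeff_inner A B (?T 0) (?T 0) / of_nat (D choose i)) else 0)"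
    proof (cases "j = i")
      case True
      have "coeff_inner A B (?T i) (?T i) = coeff_inner A B (?T 0) (?T 0) / of_nat (D choose i)"
        using ij by (intro intertwiner_norm[OF \<Phi>]) simp
      with True show ?thesis by (simp only: if_True simp_thms)
    next
      case False
      then show ?thesis using intertwiner_orthogonal[OF \<Phi> AB, of i j] ij by auto
    qed
  qed
  also have "\<dots> = (\<Sum>i\<le>D. hcoeff D P i * (cnj (hcoeff D Q i) * (coeff_inner A B (?T 0) (?T 0) / of_nat (D choose i))))"
    by (intro sum.cong refl) simp
  also have "\<dots> = coeff_inner A B (?T 0) (?T 0) * inner_V (real D / 2) P Q"
    unfolding inner_V_eq[OF P Q] sum_distrib_left by (intro sum.cong refl) (simp add: mult_ac)
  finally show ?thesis .
qed

text \<open>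
  The vectors of weight \<open>D/2\<close> killed by raising form a line: vanishing under \<open>raise\<close> is a two-term recursion
  in \<open>a\<close> along the diagonal \<open>a + b = k\<close>.
\<close>

lemma intertwiner_highest_weight:
  assumes \<Phi>: "intertwiner A B D \<Phi>" and AB: "A + B = D + 2 * k" and k: "k \<le> A" "k \<le> B"
    and a: "a \<le> A" and b: "b \<le> B"
  defines "T \<equiv> matrix_coeff A B D \<Phi>"
  shows "T 0 a b = (if a + b = k then (-1) ^ a * of_nat (k choose a) * T 0 0 k else 0)"
proof (cases "a + b = k")
  case True
  have "a \<le> k \<Longrightarrow> T 0 a (k - a) = (-1) ^ a * of_nat (k choose a) * T 0 0 k" for a
  proof (induction a)
    case (Suc a)
    have lt: "a < A" "k - Suc a < B" "a \<le> A" "k - Suc a \<le> B" and e: "Suc (k - Suc a) = k - a"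
      using Suc.prems k by auto
    from intertwiner_raise[OF \<Phi> _ lt(3,4), of 0]
    have r: "of_nat (Suc a) * T 0 (Suc a) (k - Suc a) + of_nat (k - a) * T 0 a (k - a) = 0"
      unfolding T_def[symmetric] raise_eq using lt e by (simp del: of_nat_Suc of_nat_diff)
    have bin: "of_nat (Suc a) * of_nat (k choose Suc a) = (of_nat (k - a) * of_nat (k choose a) :: complex)"
      by (rule choose_Suc_ratio)
    have "of_nat (Suc a) * T 0 (Suc a) (k - Suc a) = - (of_nat (k - a) * T 0 a (k - a))"
      using r by (simp add: eq_neg_iff_add_eq_0 del: of_nat_Suc of_nat_diff)
    also have "\<dots> = - ((-1) ^ a * T 0 0 k * (of_nat (k - a) * of_nat (k choose a)))"
      using Suc by simp
    also have "\<dots> = of_nat (Suc a) * ((-1) ^ Suc a * of_nat (k choose Suc a) * T 0 0 k)"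
      unfolding bin[symmetric] by simp
    finally show ?case
      by (subst (asm) mult_left_cancel) (simp_all del: of_nat_Suc)
  qed simp
  from this[of a] True show ?thesis by auto
next
  case False
  then show ?thesis
    using intertwiner_weight[OF \<Phi> AB _ a b, of 0] unfolding T_def by auto
qed

text \<open>
  The image of \<open>y^D\<close> generates everything under lowering.
\<close>

lemma intertwiner_eqI:
  assumes \<Phi>: "intertwiner A B D \<Phi>" and \<Psi>: "intertwiner A B D \<Psi>"
    and 0: "\<And>a b. a \<le> A \<Longrightarrow> b \<le> B \<Longrightarrow> matrix_coeff A B D \<Phi> 0 a b = matrix_coeff A B D \<Psi> 0 a b"
    and P: "P \<in> hpolys (real D / 2)"
  shows "\<Phi> P = \<Psi> P"
proof -
  have T: "matrix_coeff A B D \<Phi> i a b = matrix_coeff A B D \<Psi> i a b" if "i \<le> D" "a \<le> A" "b \<le> B" for i a b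
    using that
  proof (induction i arbitrary: a b)
    case (Suc i)
    have "lower A (\<lambda>a. matrix_coeff A B D \<Phi> i a b) a = lower A (\<lambda>a. matrix_coeff A B D \<Psi> i a b) a"
      "lower B (\<lambda>b. matrix_coeff A B D \<Phi> i a b) b = lower B (\<lambda>b. matrix_coeff A B D \<Psi> i a b) b"
      using Suc by (auto simp: coeff_deriv_def)
    then have "of_nat (D - i) * matrix_coeff A B D \<Phi> (Suc i) a b = of_nat (D - i) * matrix_coeff A B D \<Psi> (Suc i) a b"
      using intertwiner_lower[OF \<Phi>, of i a b] intertwiner_lower[OF \<Psi>, of i a b] Suc.prems
      by (simp del: of_nat_diff)
    then show ?case using Suc.prems by (subst (asm) mult_left_cancel) (auto simp del: of_nat_diff)
  qed (use 0 in auto)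
  have mem: "\<Phi> P \<in> tensor_space (real A / 2) (real B / 2)" "\<Psi> P \<in> tensor_space (real A / 2) (real B / 2)"
    using \<Phi> \<Psi> P unfolding intertwiner_def by auto
  have "tcoeff A B (\<Phi> P) a b = tcoeff A B (\<Psi> P) a b" if "a \<le> A" "b \<le> B" for a b
    using that by (simp add: intertwiner_tcoeff[OF \<Phi> P] intertwiner_tcoeff[OF \<Psi> P] T)
  then show ?thesis
    by (subst tensor_space_expand[OF mem(1)], subst tensor_space_expand[OF mem(2)]) (auto intro!: ext sum.cong)
qed

text \<open>
  The squared norm of \<open>(x2 y1 - x1 y2)^k y1^(A - k) y2^(B - k)\<close>.
\<close>

definition highest_weight_norm_sq :: "nat \<Rightarrow> nat \<Rightarrow> nat \<Rightarrow> real" where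
  "highest_weight_norm_sq A B k = (\<Sum>a\<le>k. (real (k choose a))\<^sup>2 / (real (A choose a) * real (B choose (k - a))))"

lemma highest_weight_norm_sq_pos:
  assumes "k \<le> A" "k \<le> B"
  shows "highest_weight_norm_sq A B k > 0"
  unfolding highest_weight_norm_sq_def using assms
  by (intro sum_pos divide_pos_pos mult_pos_pos zero_less_power) auto

lemma intertwiner_highest_weight_norm:
  assumes \<Phi>: "intertwiner A B D \<Phi>" and AB: "A + B = D + 2 * k" and k: "k \<le> A" "k \<le> B"
  defines "T \<equiv> matrix_coeff A B D \<Phi>"
  shows "coeff_inner A B (T 0) (T 0) = T 0 0 k * cnj (T 0 0 k) * of_real (highest_weight_norm_sq A B k)"
proof -
  have "coeff_inner A B (T 0) (T 0) = (\<Sum>a\<le>A. \<Sum>b\<le>B. if b = k - a \<and> a \<le> k then T 0 0 k * cnj (T 0 0 k)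
       * of_real ((real (k choose a))\<^sup>2 / (real (A choose a) * real (B choose b))) else 0)"
    unfolding coeff_inner_def
  proof (intro sum.cong refl)
    fix a b assume "a \<in> {..A}" "b \<in> {..B}"
    then have hw: "T 0 a b = (if a + b = k then (-1) ^ a * of_nat (k choose a) * T 0 0 k else 0)"
      unfolding T_def by (intro intertwiner_highest_weight[OF \<Phi> AB k]) auto
    have "(-1) ^ a * (-1) ^ a = (1::complex)" by (simp flip: power_add)
    then have "((-1) ^ a * of_nat (k choose a) * T 0 0 k) * cnj ((-1) ^ a * of_nat (k choose a) * T 0 0 k)
      = T 0 0 k * cnj (T 0 0 k) * (of_nat (k choose a))\<^sup>2"
      by (simp add: power2_eq_square mult_ac)
    then show "T 0 a b * cnj (T 0 a b) / of_nat ((A choose a) * (B choose b)) = (if b = k - a \<and> a \<le> k then T 0 0 k * cnj (T 0 0 k)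
       * of_real ((real (k choose a))\<^sup>2 / (real (A choose a) * real (B choose b))) else 0)"
      unfolding hw by auto
  qed
  also have "\<dots> = (\<Sum>a\<le>A. if a \<le> k then T 0 0 k * cnj (T 0 0 k)
       * of_real ((real (k choose a))\<^sup>2 / (real (A choose a) * real (B choose (k - a)))) else 0)"
  proof (rule sum.cong[OF refl])
    fix a
    have "k - a \<le> B" using k by simp
    then show "(\<Sum>b\<le>B. if b = k - a \<and> a \<le> k then T 0 0 k * cnj (T 0 0 k)
       * of_real ((real (k choose a))\<^sup>2 / (real (A choose a) * real (B choose b))) else 0)
      = (if a \<le> k then T 0 0 k * cnj (T 0 0 k)
       * of_real ((real (k choose a))\<^sup>2 / (real (A choose a) * real (B choose (k - a)))) else 0)"
      by (cases "a \<le> k") simp_all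
  qed
  also have "\<dots> = (\<Sum>a\<le>k. T 0 0 k * cnj (T 0 0 k)
       * of_real ((real (k choose a))\<^sup>2 / (real (A choose a) * real (B choose (k - a)))))"
    using k by (intro sum.mono_neutral_cong_right) auto
  finally show ?thesis
    unfolding highest_weight_norm_sq_def of_real_sum sum_distrib_left .
qed

lemma is_CG_embedding_imp_intertwiner:
  "is_CG_embedding (real A / 2) (real B / 2) (real D / 2) \<Phi> \<Longrightarrow> intertwiner A B D \<Phi>"
  unfolding is_CG_embedding_def intertwiner_def by (auto simp: PiE_def)

lemma psi_highest: "psi (real N / 2) (real N / 2) = hmono N 0"
  using psi_eq[of 0 N] by simp

lemma inner_V_highest: "inner_V (real D / 2) (hmono D 0) (hmono D 0) = 1"
proof -
  have "inner_V (real D / 2) (hmono D 0) (hmono D 0) = (\<Sum>i\<le>D. if i = 0 then 1 else 0)"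
    unfolding inner_V_eq[OF hmono_in_hpolys[OF le0] hmono_in_hpolys[OF le0]]
    by (intro sum.cong refl) (simp add: hcoeff_hmono)
  then show ?thesis by simp
qed

text \<open>
  The quantity in the sign condition of a Clebsch--Gordan embedding is a positive multiple of the
  matrix coefficient at the monomial \<open>y1^A x2^k y2^(B - k)\<close>.
\<close>

lemma intertwiner_inner_highest:
  assumes \<Phi>: "intertwiner A B D \<Phi>" and AB: "A + B = D + 2 * k" and k: "k \<le> A" "k \<le> B"
  shows "inner_tensor (real A / 2) (real B / 2) (\<Phi> (psi (real D / 2) (real D / 2)))
      (psi (real A / 2) (real A / 2) \<otimes>\<^sub>t psi (real B / 2) (real D / 2 - real A / 2))
    = matrix_coeff A B D \<Phi> 0 0 k * of_real (sqrt (real (B choose k)) / real (B choose k))"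
proof -
  let ?s = "complex_of_real (sqrt (real (B choose k)))"
  let ?G = "psi (real A / 2) (real A / 2) \<otimes>\<^sub>t psi (real B / 2) (real D / 2 - real A / 2)"
  have "real A + real B = real D + 2 * real k"
    using AB by (metis of_nat_add of_nat_mult of_nat_numeral)
  then have e: "real D / 2 - real A / 2 = real B / 2 - real k" by (simp add: field_simps)
  have G: "?G = (\<lambda>(p, q). \<Sum>a\<le>A. \<Sum>b\<le>B. (if a = 0 \<and> b = k then ?s else 0) * hmono A a p * hmono B b q)"
  proof (rule ext, clarify)
    fix x1 y1 x2 y2 :: complex
    let ?p = "(x1, y1)" and ?q = "(x2, y2)"
    have "(\<Sum>a\<le>A. \<Sum>b\<le>B. (if a = 0 \<and> b = k then ?s else 0) * hmono A a ?p * hmono B b ?q)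
      = (\<Sum>a\<le>A. if a = 0 then ?s * hmono A 0 ?p * hmono B k ?q else 0)"
    proof (rule sum.cong[OF refl])
      fix a
      have "(\<Sum>b\<le>B. (if a = 0 \<and> b = k then ?s else 0) * hmono A a ?p * hmono B b ?q)
        = (\<Sum>b\<le>B. if b = k then (if a = 0 then ?s * hmono A 0 ?p * hmono B k ?q else 0) else 0)"
        by (intro sum.cong refl) auto
      then show "(\<Sum>b\<le>B. (if a = 0 \<and> b = k then ?s else 0) * hmono A a ?p * hmono B b ?q)
        = (if a = 0 then ?s * hmono A 0 ?p * hmono B k ?q else 0)"
        using k by simp
    qed
    then show "?G (?p, ?q) = (\<Sum>a\<le>A. \<Sum>b\<le>B. (if a = 0 \<and> b = k then ?s else 0) * hmono A a ?p * hmono B b ?q)"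
      unfolding e psi_highest psi_eq[OF k(2)] by (simp add: tensor_def)
  qed
  then have Gmem: "?G \<in> tensor_space (real A / 2) (real B / 2)"
    unfolding mem_tensor_space_iff by (rule exI[where x = "\<lambda>a b. if a = 0 \<and> b = k then ?s else 0"])
  have mem: "\<Phi> (hmono D 0) \<in> tensor_space (real A / 2) (real B / 2)"
    using \<Phi> hmono_in_hpolys[of 0 D] unfolding intertwiner_def by auto
  have "inner_tensor (real A / 2) (real B / 2) (\<Phi> (hmono D 0)) ?G
     = (\<Sum>a\<le>A. \<Sum>b\<le>B. if b = k then (if a = 0 then matrix_coeff A B D \<Phi> 0 0 k * ?s / of_nat (B choose k) else 0) else 0)"
    unfolding inner_tensor_eq[OF mem Gmem]
    by (intro sum.cong refl) (auto simp: G tcoeff_sum matrix_coeff_def)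
  also have "\<dots> = matrix_coeff A B D \<Phi> 0 0 k * ?s / of_nat (B choose k)"
    using k by simp
  finally show ?thesis unfolding psi_highest by simp
qed

text \<open>
  Isometry fixes the modulus of the free scalar and the sign condition fixes its phase.
\<close>

lemma CG_embedding_highest_weight:
  assumes \<Phi>: "is_CG_embedding (real A / 2) (real B / 2) (real D / 2) \<Phi>"
    and AB: "A + B = D + 2 * k" and k: "k \<le> A" "k \<le> B"
  shows "matrix_coeff A B D \<Phi> 0 0 k = of_real (1 / sqrt (highest_weight_norm_sq A B k))"
proof -
  let ?T = "matrix_coeff A B D \<Phi> 0 0 k"
  define r where "r = sqrt (real (B choose k)) / real (B choose k)"
  have r: "r > 0" using k by (simp add: r_def)
  note int = is_CG_embedding_imp_intertwiner[OF \<Phi>]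
  have pos: "?T * of_real r \<in> \<real>" "Re (?T * of_real r) > 0"
    using \<Phi> intertwiner_inner_highest[OF int AB k]
    unfolding is_CG_embedding_def by (auto simp: r_def Let_def)
  then obtain t where t: "?T = of_real t"
  proof -
    from pos(1) obtain u where "?T * of_real r = of_real u" by (auto elim: Reals_cases)
    then have "?T = of_real (u / r)" using r by (simp add: field_simps)
    then show ?thesis by (rule that)
  qed
  with pos(2) r have tpos: "t > 0" by (simp add: zero_less_mult_iff)
  have mem: "hmono D 0 \<in> hpolys (real D / 2)" by (simp add: hmono_in_hpolys)
  have "inner_tensor (real A / 2) (real B / 2) (\<Phi> (hmono D 0)) (\<Phi> (hmono D 0)) = 1"
    using \<Phi> mem unfolding is_CG_embedding_def by (auto simp: inner_V_highest)
  then have "coeff_inner A B (matrix_coeff A B D \<Phi> 0) (matrix_coeff A B D \<Phi> 0) = 1"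
    unfolding intertwiner_inner[OF int AB mem mem] inner_V_highest by simp
  then have "complex_of_real (t * t * highest_weight_norm_sq A B k) = 1"
    unfolding intertwiner_highest_weight_norm[OF int AB k] t by simp
  then have "t\<^sup>2 * highest_weight_norm_sq A B k = 1"
    by (simp only: of_real_eq_1_iff power2_eq_square)
  then have "t\<^sup>2 = 1 / highest_weight_norm_sq A B k"
    using highest_weight_norm_sq_pos[OF k] by (simp add: field_simps)
  then have "t = sqrt (1 / highest_weight_norm_sq A B k)"
    using tpos by (metis less_eq_real_def real_sqrt_unique)
  then show ?thesis unfolding t by (simp add: real_sqrt_divide)
qed

section \<open>Hahn polynomials and an alternating sum of binomial products\<close>

text \<open>
  The alternating sum that comes out of expanding \<open>cg_map\<close> on monomials; \<open>a, c, b, d\<close> are the exponents of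
  \<open>x1, y1, x2, y2\<close> in the target monomial.  The guards replace the convention that a binomial
  coefficient with negative lower index is zero.
\<close>

definition cg_sum :: "nat \<Rightarrow> nat \<Rightarrow> nat \<Rightarrow> nat \<Rightarrow> nat \<Rightarrow> int" where
  "cg_sum k a b c d = (\<Sum>s\<le>k. (-1) ^ s * int ((k choose s) * 
      (if s \<le> a \<and> s \<le> d then (a + b - k choose (a - s)) * (c + d - k choose (d - s)) else 0)))"

text \<open>
  Binomial inversion: \<open>(n choose r) (r choose s) = (n choose s) (n - s choose r - s)\<close>, and what is left
  is the expansion of \<open>(1 - 1)^(n - s)\<close>.
\<close>

lemma alternating_binomial_inversion:
  "(\<Sum>r\<le>n. (-1) ^ r * int ((n choose r) * (r choose s))) = (if s = n then (-1) ^ n else 0)"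
proof (cases "s \<le> n")
  case True
  have "(\<Sum>r\<le>n. (-1) ^ r * int ((n choose r) * (r choose s)))
     = (\<Sum>r=s..n. (-1) ^ r * int ((n choose r) * (r choose s)))"
    by (rule sum.mono_neutral_right) auto
  also have "\<dots> = (\<Sum>r=s..n. (-1) ^ r * int ((n choose s) * ((n - s) choose (r - s))))"
    by (intro sum.cong refl) (simp add: choose_mult)
  also have "\<dots> = (\<Sum>j\<le>n-s. (-1) ^ (j + s) * int ((n choose s) * ((n - s) choose j)))"
    using True by (intro sum.reindex_bij_witness[of _ "\<lambda>j. j + s" "\<lambda>r. r - s"]) auto
  also have "\<dots> = (-1) ^ s * int (n choose s) * (\<Sum>j\<le>n-s. (-1) ^ j * of_nat ((n - s) choose j))"
    unfolding sum_distrib_left by (intro sum.cong refl) (simp add: power_add mult_ac)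
  also have "\<dots> = (if s = n then (-1) ^ n else 0)"
    using True choose_alternating_sum[of "n - s", where ?'a = int] by (cases "s = n") auto
  finally show ?thesis .
qed (auto intro!: sum.neutral simp: binomial_eq_0)

text \<open>
  Vandermonde's identity splits \<open>r\<close> off the first binomial coefficient and \<open>k - r\<close> off the second one.
  The sum over \<open>r\<close> can then be carried out by binomial inversion and leaves only the diagonal of the two new
  summation indices.
\<close>

lemma cg_sum_alt:
  assumes "k \<le> a + b" "k \<le> c + d"
  shows "(\<Sum>r\<le>k. (-1) ^ r * int ((k choose r) * ((a + b - k + r choose a) * (c + d - r choose c)))) = cg_sum k a b c d"
proof -
  let ?p = "a + b - k" and ?q = "c + d - k"
  have vand1: "(?p + r choose a) = (\<Sum>s\<le>k. (r choose s) * (if s \<le> a then ?p choose (a - s) else 0))" if "r \<le> k" for r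
  proof -
    have "(?p + r choose a) = (\<Sum>s\<le>a. (r choose s) * (?p choose (a - s)))"
      by (simp add: vandermonde add.commute)
    also have "\<dots> = (\<Sum>s\<le>max a k. (r choose s) * (if s \<le> a then ?p choose (a - s) else 0))"
      by (rule sum.mono_neutral_cong_left) auto
    also have "\<dots> = (\<Sum>s\<le>k. (r choose s) * (if s \<le> a then ?p choose (a - s) else 0))"
      using that by (intro sum.mono_neutral_right) auto
    finally show ?thesis .
  qed
  have vand2: "(c + d - r choose c) = (\<Sum>t\<le>k. (k - r choose (k - t)) * (if t \<le> d then ?q choose (d - t) else 0))" if "r \<le> k" for r
  proof -
    have "(c + d - r choose c) = (c + d - r choose (d - r))" if "r \<le> d"
      using that by (subst binomial_symmetric) auto
    have sub: "(?q choose (c - t)) = (if k \<le> d + t then ?q choose (d + t - k) else 0)" if "t \<le> c" "t \<le> k" for t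
    proof (cases "k \<le> d + t")
      case True
      then show ?thesis using that assms by (subst binomial_symmetric) auto
    qed (use that assms in \<open>auto intro!: binomial_eq_0\<close>)
    have "(c + d - r choose c) = ((k - r) + ?q choose c)"
      using that assms by (intro arg_cong2[of _ _ _ _ binomial]) auto
    also have "\<dots> = (\<Sum>t\<le>c. (k - r choose t) * (?q choose (c - t)))"
      by (rule vandermonde[symmetric])
    also have "\<dots> = (\<Sum>t\<le>max c k. (k - r choose t) * (if t \<le> c then ?q choose (c - t) else 0))"
      by (rule sum.mono_neutral_cong_left) auto
    also have "\<dots> = (\<Sum>t\<le>k. (k - r choose t) * (if t \<le> c then ?q choose (c - t) else 0))"
      by (intro sum.mono_neutral_right) auto
    also have "\<dots> = (\<Sum>t\<le>k. (k - r choose t) * (if k \<le> d + t then ?q choose (d + t - k) else 0))"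
    proof (intro sum.cong refl arg_cong2[of _ _ _ _ times])
      fix t assume "t \<in> {..k}"
      then show "(if t \<le> c then ?q choose (c - t) else 0) = (if k \<le> d + t then ?q choose (d + t - k) else 0)"
        using sub[of t] assms by (auto intro!: binomial_eq_0[symmetric])
    qed
    also have "\<dots> = (\<Sum>t\<le>k. (k - r choose (k - t)) * (if t \<le> d then ?q choose (d - t) else 0))"
      by (rule sum.reindex_bij_witness[of _ "\<lambda>t. k - t" "\<lambda>t. k - t"]) auto
    finally show ?thesis .
  qed
  define f where "f s = (if s \<le> a then ?p choose (a - s) else 0)" for s
  define g where "g t = (if t \<le> d then ?q choose (d - t) else 0)" for t
  \<comment> \<open>Choosing \<open>r\<close> elements out of \<open>k\<close> and then a superset of size \<open>t\<close>, or the other way round.\<close>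
  have tri: "(k choose r) * (k - r choose (k - t)) = (k choose t) * (t choose r)" if "r \<le> k" "t \<le> k" for r t
  proof (cases "r \<le> t")
    case True
    then have "(k - r choose (k - t)) = (k - r choose (t - r))"
      using that by (subst binomial_symmetric) auto
    then show ?thesis using True that by (simp add: choose_mult)
  next
    case False
    then have "(k - r choose (k - t)) = 0" "(t choose r) = 0"
      using that by (auto intro!: binomial_eq_0)
    then show ?thesis by (simp only: mult_0_right)
  qed
  have "(\<Sum>r\<le>k. (-1) ^ r * int ((k choose r) * ((?p + r choose a) * (c + d - r choose c))))
     = (\<Sum>r\<le>k. (-1) ^ r * int ((k choose r) * ((\<Sum>s\<le>k. (r choose s) * f s) * (\<Sum>t\<le>k. (k - r choose (k - t)) * g t))))"
    unfolding f_def g_def by (intro sum.cong refl) (simp only: vand1 vand2 atMost_iff)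
  also have "\<dots> = (\<Sum>r\<le>k. \<Sum>s\<le>k. \<Sum>t\<le>k. (-1) ^ r * int (((k choose r) * (k - r choose (k - t))) * (r choose s) * f s * g t))"
  proof (rule sum.cong[OF refl])
    fix r
    have "(k choose r) * ((\<Sum>s\<le>k. (r choose s) * f s) * (\<Sum>t\<le>k. (k - r choose (k - t)) * g t))
       = (\<Sum>s\<le>k. \<Sum>t\<le>k. ((k choose r) * (k - r choose (k - t))) * (r choose s) * f s * g t)"
      unfolding sum_product unfolding sum_distrib_left by (intro sum.cong refl) (simp only: mult_ac)
    then show "(-1) ^ r * int ((k choose r) * ((\<Sum>s\<le>k. (r choose s) * f s) * (\<Sum>t\<le>k. (k - r choose (k - t)) * g t)))
       = (\<Sum>s\<le>k. \<Sum>t\<le>k. (-1) ^ r * int (((k choose r) * (k - r choose (k - t))) * (r choose s) * f s * g t))"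
      by (simp only: of_nat_sum sum_distrib_left)
  qed
  also have "\<dots> = (\<Sum>r\<le>k. \<Sum>s\<le>k. \<Sum>t\<le>k. (int ((k choose t) * f s * g t)) * ((-1) ^ r * int ((t choose r) * (r choose s))))"
    by (intro sum.cong refl) (simp only: tri atMost_iff, simp add: mult_ac)
  also have "\<dots> = (\<Sum>s\<le>k. \<Sum>t\<le>k. (int ((k choose t) * f s * g t)) * (\<Sum>r\<le>k. (-1) ^ r * int ((t choose r) * (r choose s))))"
    unfolding sum_distrib_left by (subst sum.swap, rule sum.cong[OF refl], rule sum.swap)
  also have "\<dots> = (\<Sum>s\<le>k. \<Sum>t\<le>k. (int ((k choose t) * f s * g t)) * (if s = t then (-1) ^ t else 0))"
  proof (intro sum.cong refl arg_cong2[of _ _ _ _ times])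
    fix s t assume "t \<in> {..k}"
    then have "(\<Sum>r\<le>k. (-1) ^ r * int ((t choose r) * (r choose s))) = (\<Sum>r\<le>t. (-1) ^ r * int ((t choose r) * (r choose s)))"
      by (intro sum.mono_neutral_right) auto
    then show "(\<Sum>r\<le>k. (-1) ^ r * int ((t choose r) * (r choose s))) = (if s = t then (-1) ^ t else 0)"
      by (simp only: alternating_binomial_inversion)
  qed
  also have "\<dots> = (\<Sum>s\<le>k. (int ((k choose s) * f s * g s)) * (-1) ^ s)"
    by (intro sum.cong refl) (simp add: if_distrib[of "(*) _"] cong: if_cong)
  also have "\<dots> = cg_sum k a b c d"
    unfolding cg_sum_def f_def g_def by (intro sum.cong refl) auto
  finally show ?thesis .
qed

lemma fact_mult_pochhammer: "fact n * pochhammer (int n + 1) r = (fact (n + r) :: int)"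
  using pochhammer_product[of n "n + r" "1::int"] by (simp add: pochhammer_fact[symmetric] add.commute)

lemma pochhammer_minus_int: "pochhammer (- int n) r = (-1) ^ r * (fact r * int (n choose r))"
proof (cases "r \<le> n")
  case True
  have "real_of_int (pochhammer (- int n) r) = pochhammer (- real n) r"
    by (simp add: pochhammer_of_int[symmetric])
  also have "\<dots> = (-1) ^ r * (fact r * (real n gchoose r))"
    by (simp add: gbinomial_pochhammer)
  also have "\<dots> = real_of_int ((-1) ^ r * (fact r * int (n choose r)))"
    by (simp add: binomial_gbinomial)
  finally show ?thesis by (simp only: of_int_eq_iff)
next
  case False
  then have "n < r" by simp
  then show ?thesis by (simp add: pochhammer_of_nat_eq_0_iff binomial_eq_0)
qed

text \<open>
  Each rising factorial in the Hahn polynomial is a quotient of factorials up to sign.  After multiplication by the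
  two denominators these combine to the binomial coefficients of \<open>cg_sum_alt\<close>; the signs of
  \<open>(-x)\<^sub>r\<close> and \<open>(x - c)\<^bsub>k-r\<^esub>\<close> contribute the factor \<open>(-1)^k\<close>.
\<close>

lemma hahn_eq_cg_sum:
  assumes "k \<le> a + b" "k \<le> c + d" "k \<le> a + c" "k \<le> b + d"
  shows "fact (a + b - k) * fact (c + d - k) * hahn (int k) (int c + int d) (int a + int b) (int b + int d) (int d)
    = (-1) ^ k * (fact a * fact b * fact c * fact d) * cg_sum k a b c d"
proof -
  let ?p = "a + b - k" and ?q = "c + d - k"
  have "hahn (int k) (int c + int d) (int a + int b) (int b + int d) (int d)
     = (\<Sum>r \<in> {max 0 (int k - int b)..min (int k) (int d)}.
      (-1) ^ nat r * int (k choose nat r)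
        * pochhammer (int ?p + 1) (nat r) * pochhammer (- int d) (nat r)
        * pochhammer (int ?q + 1) (k - nat r) * pochhammer (- int b) (k - nat r))"
    unfolding hahn_def using assms
    by (intro sum.cong arg_cong2[of _ _ _ _ times] arg_cong2[of _ _ _ _ pochhammer] arg_cong2[of _ _ _ _ atLeastAtMost] refl)
       (auto simp: of_nat_diff nat_diff_distrib)
  also have "\<dots> = (\<Sum>r \<in> {k - b..min k d}. (-1) ^ r * int (k choose r)
        * pochhammer (int ?p + 1) r * pochhammer (- int d) r
        * pochhammer (int ?q + 1) (k - r) * pochhammer (- int b) (k - r))"
    by (rule sum.reindex_bij_witness[of _ int nat]) auto
  also have "\<dots> = (\<Sum>r\<le>k. (-1) ^ r * int (k choose r)
        * pochhammer (int ?p + 1) r * pochhammer (- int d) r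
        * pochhammer (int ?q + 1) (k - r) * pochhammer (- int b) (k - r))"
    by (rule sum.mono_neutral_left) (auto simp: pochhammer_of_nat_eq_0_iff)
  finally have "fact ?p * fact ?q * hahn (int k) (int c + int d) (int a + int b) (int b + int d) (int d)
    = (\<Sum>r\<le>k. (-1) ^ r * int (k choose r) * (fact ?p * pochhammer (int ?p + 1) r) * pochhammer (- int d) r
        * (fact ?q * pochhammer (int ?q + 1) (k - r)) * pochhammer (- int b) (k - r))"
    by (simp add: sum_distrib_left mult_ac)
  also have "\<dots> = (\<Sum>r\<le>k. (-1) ^ k * (fact a * fact b * fact c * fact d)
       * ((-1) ^ r * int ((k choose r) * ((?p + r choose a) * (c + d - r choose c)))))"
  proof (rule sum.cong[OF refl])
    fix r assume "r \<in> {..k}"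
    then have r: "r \<le> k" by simp
    have 1: "fact (?p + r) * (fact (k - r) * int (b choose (k - r))) = fact a * fact b * int (?p + r choose a)"
    proof (cases "k - r \<le> b")
      case True
      then have "?p + r - a = b - (k - r)" using r assms by auto
      moreover have p1: "fact (?p + r) = fact a * fact (?p + r - a) * (?p + r choose a)"
        using True r assms by (intro binomial_fact_lemma[symmetric]) auto
      moreover have p2: "fact b = fact (k - r) * fact (b - (k - r)) * (b choose (k - r))"
        using True by (rule binomial_fact_lemma[symmetric])
      ultimately have "fact (?p + r) * (fact (k - r) * (b choose (k - r))) = fact a * fact b * (?p + r choose a)"
        by (simp only: p1 p2 mult_ac)
      from arg_cong[OF this, of int] show ?thesis by simp
    next
      case False
      then have "?p + r < a" using r assms by auto
      then show ?thesis using False by (simp add: binomial_eq_0)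
    qed
    have 2: "fact (?q + (k - r)) * (fact r * int (d choose r)) = fact c * fact d * int (c + d - r choose c)"
    proof (cases "r \<le> d")
      case True
      then have e: "?q + (k - r) = c + d - r" "c + d - r - c = d - r" using r assms by auto
      moreover have p1: "fact (c + d - r) = fact c * fact (c + d - r - c) * (c + d - r choose c)"
        using True by (intro binomial_fact_lemma[symmetric]) auto
      moreover have p2: "fact d = fact r * fact (d - r) * (d choose r)"
        using True by (rule binomial_fact_lemma[symmetric])
      ultimately have "fact (?q + (k - r)) * (fact r * (d choose r)) = fact c * fact d * (c + d - r choose c)"
        by (simp only: p1 p2 e mult_ac)
      from arg_cong[OF this, of int] show ?thesis by simp
    next
      case False
      then have "c + d - r < c" using r assms by auto
      then show ?thesis using False by (simp add: binomial_eq_0)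
    qed
    have "(-1) ^ r * int (k choose r) * (fact ?p * pochhammer (int ?p + 1) r) * pochhammer (- int d) r
        * (fact ?q * pochhammer (int ?q + 1) (k - r)) * pochhammer (- int b) (k - r)
      = ((-1) ^ r * (-1) ^ (k - r)) * ((-1) ^ r * int (k choose r)) * (fact (?p + r) * (fact (k - r) * int (b choose (k - r))))
         * (fact (?q + (k - r)) * (fact r * int (d choose r)))"
      unfolding fact_mult_pochhammer pochhammer_minus_int by (simp only: mult_ac)
    also have "(-1) ^ r * (-1) ^ (k - r) = (-1 :: int) ^ k"
      using r by (simp flip: power_add)
    finally show "(-1) ^ r * int (k choose r) * (fact ?p * pochhammer (int ?p + 1) r) * pochhammer (- int d) r
        * (fact ?q * pochhammer (int ?q + 1) (k - r)) * pochhammer (- int b) (k - r)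
      = (-1) ^ k * (fact a * fact b * fact c * fact d)
       * ((-1) ^ r * int ((k choose r) * ((?p + r choose a) * (c + d - r choose c))))"
      unfolding 1 2 by (simp add: mult_ac)
  qed
  also have "\<dots> = (-1) ^ k * (fact a * fact b * fact c * fact d) * cg_sum k a b c d"
    unfolding sum_distrib_left[symmetric] using assms by (subst cg_sum_alt) auto
  finally show ?thesis .
qed

lemma real_hahn_eq_cg_sum:
  assumes "k \<le> a + b" "k \<le> c + d" "k \<le> a + c" "k \<le> b + d"
  shows "real_of_int (hahn (int k) (int c + int d) (int a + int b) (int b + int d) (int d))
    = (-1) ^ k * (fact a * fact b * fact c * fact d / (fact (a + b - k) * fact (c + d - k))) * real_of_int (cg_sum k a b c d)"
proof -
  have "real_of_int (fact (a + b - k) * fact (c + d - k) * hahn (int k) (int c + int d) (int a + int b) (int b + int d) (int d))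
    = real_of_int ((-1) ^ k * (fact a * fact b * fact c * fact d) * cg_sum k a b c d)"
    unfolding hahn_eq_cg_sum[OF assms] ..
  then have "(fact (a + b - k) * fact (c + d - k)) * real_of_int (hahn (int k) (int c + int d) (int a + int b) (int b + int d) (int d))
    = (-1) ^ k * (fact a * fact b * fact c * fact d) * real_of_int (cg_sum k a b c d)"
    by simp
  then show ?thesis by (simp add: divide_simps mult_ac)
qed

section \<open>The Clebsch--Gordan embedding\<close>

text \<open>
  The determinant of \<open>q\<close> and \<open>p\<close> to the power \<open>k\<close>, times the polarisation of \<open>P\<close> of degree \<open>B - k\<close>
  in \<open>q\<close>.  The order of the vectors in the determinant is chosen such that the coefficient of \<open>y1^A x2^k y2^(B - k)\<close> in the image of \<open>y^D\<close> is positive.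
\<close>

definition cg_map :: "nat \<Rightarrow> nat \<Rightarrow> nat \<Rightarrow> (complex \<times> complex \<Rightarrow> complex)
    \<Rightarrow> (complex \<times> complex) \<times> (complex \<times> complex) \<Rightarrow> complex" where
  "cg_map B D k P = (\<lambda>((x1, y1), (x2, y2)).
     (x2 * y1 - x1 * y2) ^ k * dft_coeff D (B - k) (\<lambda>t. P (x1 + t * x2, y1 + t * y2)))"

lemma cg_map_linear: "cg_map B D k (\<lambda>p. s * P p + t * Q p) = (\<lambda>z. s * cg_map B D k P z + t * cg_map B D k Q z)"
  by (auto simp: cg_map_def fun_eq_iff dft_coeff_add dft_coeff_cmult algebra_simps)

lemma cg_map_equivariant:
  assumes "g \<in> SU2"
  shows "cg_map B D k (act g P) = tensor_act g (cg_map B D k P)"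
proof (rule ext, clarify)
  fix x1 y1 x2 y2
  have det: "g$1$1 * g$2$2 - g$1$2 * g$2$1 = 1"
    using assms by (simp add: SU2_def det_2)
  define X1 Y1 X2 Y2 where "X1 = g$1$1 * x1 + g$2$1 * y1" "Y1 = g$1$2 * x1 + g$2$2 * y1"
    "X2 = g$1$1 * x2 + g$2$1 * y2" "Y2 = g$1$2 * x2 + g$2$2 * y2"
  note XY_defs = this
  have "X2 * Y1 - X1 * Y2 = (g$1$1 * g$2$2 - g$1$2 * g$2$1) * (x2 * y1 - x1 * y2)"
    unfolding XY_defs by algebra
  then have bracket: "X2 * Y1 - X1 * Y2 = x2 * y1 - x1 * y2"
    unfolding det by simp
  have "subst g (x1 + t * x2, y1 + t * y2) = (X1 + t * X2, Y1 + t * Y2)" for t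
    by (simp add: subst_def XY_defs algebra_simps)
  then have "cg_map B D k (act g P) ((x1, y1), (x2, y2))
      = (x2 * y1 - x1 * y2) ^ k * dft_coeff D (B - k) (\<lambda>t. P (X1 + t * X2, Y1 + t * Y2))"
    by (simp add: cg_map_def act_def)
  also have "\<dots> = tensor_act g (cg_map B D k P) ((x1, y1), (x2, y2))"
    unfolding bracket[symmetric] by (simp add: cg_map_def tensor_act_def subst_def XY_defs)
  finally show "cg_map B D k (act g P) ((x1, y1), (x2, y2)) = tensor_act g (cg_map B D k P) ((x1, y1), (x2, y2))" .
qed

text \<open>
  Three binomial expansions: of the determinant (index \<open>r\<close>) and of the powers of \<open>x1 + t x2\<close> and
  \<open>y1 + t y2\<close> (indices \<open>s\<close> and \<open>u\<close>).  The target monomial and the degree in \<open>t\<close> determine \<open>s\<close> and \<open>u\<close>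
  from \<open>r\<close>, so that one sum remains.
\<close>

lemma cg_map_hmono:
  assumes AB: "A + B = D + 2 * k" and k: "k \<le> A" "k \<le> B" and i: "i \<le> D"
  shows "cg_map B D k (hmono D i) = (\<lambda>(p, q). \<Sum>a\<le>A. \<Sum>b\<le>B.
    (if a + b = i + k then of_int (cg_sum k a b (A - a) (B - b)) else 0) * hmono A a p * hmono B b q)"
proof (rule ext, clarify)
  fix x1 y1 x2 y2 :: complex
  define \<beta> where "\<beta> = B - k"
  have \<beta>: "\<beta> \<le> D" using AB k by (simp add: \<beta>_def)
  have B: "B = \<beta> + k" using k by (simp add: \<beta>_def)
  define m where "m a b = hmono A a (x1, y1) * hmono B b (x2, y2)" for a b
  have "dft_coeff D \<beta> (\<lambda>t. hmono D i (x1 + t * x2, y1 + t * y2))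
    = (\<Sum>s\<le>i. \<Sum>u\<le>D - i. if s + u = \<beta> then of_nat ((i choose s) * (D - i choose u)) *
        (x1 ^ (i - s) * x2 ^ s * y1 ^ (D - i - u) * y2 ^ u) else 0)"
  proof -
    have expand: "hmono D i (x1 + t * x2, y1 + t * y2)
      = (\<Sum>s\<le>i. \<Sum>u\<le>D - i. of_nat ((i choose s) * (D - i choose u)) *
        (x1 ^ (i - s) * x2 ^ s * y1 ^ (D - i - u) * y2 ^ u) * t ^ (s + u))" for t
    proof -
      have "hmono D i (x1 + t * x2, y1 + t * y2) = (t * x2 + x1) ^ i * (t * y2 + y1) ^ (D - i)"
        by (simp add: hmono_def add.commute)
      also have "\<dots> = (\<Sum>s\<le>i. \<Sum>u\<le>D - i. of_nat ((i choose s) * (D - i choose u)) *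
        (x1 ^ (i - s) * x2 ^ s * y1 ^ (D - i - u) * y2 ^ u) * t ^ (s + u))"
        unfolding binomial_ring sum_product
        by (intro sum.cong refl) (simp add: power_mult_distrib power_add mult_ac)
      finally show ?thesis .
    qed
    have monomial: "dft_coeff D \<beta> (\<lambda>t. c * t ^ n) = (if n = \<beta> then c else 0)" if "n \<le> D" for n c
    proof -
      have "(\<lambda>t. c * t ^ n) = (\<lambda>t. \<Sum>j\<le>D. (if j = n then c else 0) * t ^ j)"
        using that by (simp add: if_distrib[of "\<lambda>c. c * _"] cong: if_cong)
      then show ?thesis using dft_coeff_polynomial[OF \<beta>, of "\<lambda>j. if j = n then c else 0"] by simp
    qed
    show ?thesis
      unfolding expand dft_coeff_sum using i by (intro sum.cong refl) (subst monomial, auto)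
  qed
  moreover have "(x2 * y1 - x1 * y2) ^ k
     = (\<Sum>r\<le>k. of_nat (k choose r) * ((-1) ^ r * (x1 ^ r * y2 ^ r * x2 ^ (k - r) * y1 ^ (k - r))))"
  proof -
    have "(x2 * y1 - x1 * y2) ^ k = (- (x1 * y2) + x2 * y1) ^ k" by simp
    then show ?thesis
      unfolding binomial_ring by (simp add: power_minus[of "x1 * y2"] power_mult_distrib mult_ac)
  qed
  ultimately have "cg_map B D k (hmono D i) ((x1, y1), (x2, y2))
    = (\<Sum>r\<le>k. of_nat (k choose r) * ((-1) ^ r * (x1 ^ r * y2 ^ r * x2 ^ (k - r) * y1 ^ (k - r)))) *
      (\<Sum>s\<le>i. \<Sum>u\<le>D - i. if s + u = \<beta> then of_nat ((i choose s) * (D - i choose u)) *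
        (x1 ^ (i - s) * x2 ^ s * y1 ^ (D - i - u) * y2 ^ u) else 0)"
    by (simp add: cg_map_def \<beta>_def)
  also have "\<dots> = (\<Sum>r\<le>k. \<Sum>s\<le>i. \<Sum>u\<le>D - i. if s + u = \<beta> then
      ((-1) ^ r * of_nat ((k choose r) * (i choose s) * (D - i choose u))) * m (i - s + r) (s + (k - r)) else 0)"
    unfolding sum_distrib_right unfolding sum_distrib_left
  proof (intro sum.cong refl)
    fix r s u assume *: "r \<in> {..k}" "s \<in> {..i}" "u \<in> {..D - i}"
    show "of_nat (k choose r) * ((-1) ^ r * (x1 ^ r * y2 ^ r * x2 ^ (k - r) * y1 ^ (k - r))) *
      (if s + u = \<beta> then of_nat ((i choose s) * (D - i choose u)) *
        (x1 ^ (i - s) * x2 ^ s * y1 ^ (D - i - u) * y2 ^ u) else 0)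
      = (if s + u = \<beta> then
      ((-1) ^ r * of_nat ((k choose r) * (i choose s) * (D - i choose u))) * m (i - s + r) (s + (k - r)) else 0)"
    proof (cases "s + u = \<beta>")
      case True
      then have "A - (i - s + r) = (D - i - u) + (k - r)" "B - (s + (k - r)) = u + r"
        using * AB k i by (auto simp: \<beta>_def)
      then show ?thesis using True by (simp add: m_def hmono_def power_add mult_ac)
    qed simp
  qed
  also have "\<dots> = (\<Sum>r\<le>k. \<Sum>s\<le>i. \<Sum>u\<le>D - i. \<Sum>a\<le>A. \<Sum>b\<le>B. if s + u = \<beta> \<and> a = i - s + r \<and> b = s + (k - r) then
      ((-1) ^ r * of_nat ((k choose r) * (i choose s) * (D - i choose u))) * m a b else 0)"
  proof (intro sum.cong refl)
    fix r s u assume *: "r \<in> {..k}" "s \<in> {..i}" "u \<in> {..D - i}"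
    let ?c = "(-1) ^ r * of_nat ((k choose r) * (i choose s) * (D - i choose u)) :: complex"
    show "(if s + u = \<beta> then ?c * m (i - s + r) (s + (k - r)) else 0) = (\<Sum>a\<le>A. \<Sum>b\<le>B. if s + u = \<beta> \<and> a = i - s + r \<and> b = s + (k - r) then
        ?c * m a b else 0)"
    proof (cases "s + u = \<beta>")
      case True
      have le: "i - s + r \<le> A" "s + (k - r) \<le> B"
        using * AB k i True by (auto simp: \<beta>_def)
      have "(\<Sum>a\<le>A. \<Sum>b\<le>B. if s + u = \<beta> \<and> a = i - s + r \<and> b = s + (k - r) then ?c * m a b else 0)
        = (\<Sum>a\<le>A. if a = i - s + r then ?c * m a (s + (k - r)) else 0)"
      proof (rule sum.cong[OF refl])
        fix a
        show "(\<Sum>b\<le>B. if s + u = \<beta> \<and> a = i - s + r \<and> b = s + (k - r) then ?c * m a b else 0)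
          = (if a = i - s + r then ?c * m a (s + (k - r)) else 0)"
          using le True by (cases "a = i - s + r") simp_all
      qed
      then show ?thesis using le True by simp
    qed simp
  qed
  also have "\<dots> = (\<Sum>a\<le>A. \<Sum>b\<le>B. \<Sum>r\<le>k. \<Sum>s\<le>i. \<Sum>u\<le>D - i. if s + u = \<beta> \<and> a = i - s + r \<and> b = s + (k - r) then
      ((-1) ^ r * of_nat ((k choose r) * (i choose s) * (D - i choose u))) * m a b else 0)"
    unfolding sum.cartesian_product
    by (rule sum.reindex_bij_witness[of _ "\<lambda>(a, b, r, s, u). (r, s, u, a, b)" "\<lambda>(r, s, u, a, b). (a, b, r, s, u)"]) auto
  also have "\<dots> = (\<Sum>a\<le>A. \<Sum>b\<le>B. (if a + b = i + k then of_int (cg_sum k a b (A - a) (B - b)) else 0) * m a b)"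
  proof (intro sum.cong refl)
    fix a b assume ab: "a \<in> {..A}" "b \<in> {..B}"
    \<comment> \<open>For fixed \<open>a, b, r\<close> the conditions in the sum leave at most one pair \<open>(s, u)\<close>.\<close>
    define R where "R r = (\<Sum>s\<le>i. \<Sum>u\<le>D - i. if s + u = \<beta> \<and> a = i - s + r \<and> b = s + (k - r)
       then of_nat ((i choose s) * (D - i choose u)) else (0::complex))" for r
    have "(\<Sum>r\<le>k. \<Sum>s\<le>i. \<Sum>u\<le>D - i. if s + u = \<beta> \<and> a = i - s + r \<and> b = s + (k - r) then
      ((-1) ^ r * of_nat ((k choose r) * (i choose s) * (D - i choose u))) * m a b else 0)
      = (\<Sum>r\<le>k. (-1) ^ r * of_nat (k choose r) * R r) * m a b"
      unfolding R_def sum_distrib_right unfolding sum_distrib_left sum_distrib_right by (intro sum.cong refl) auto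
    also have "(\<Sum>r\<le>k. (-1) ^ r * of_nat (k choose r) * R r)
      = (if a + b = i + k then of_int (cg_sum k a b (A - a) (B - b)) else 0)"
    proof (cases "a + b = i + k")
      case True
      have ik: "i = a + b - k" "D - i = A - a + (B - b) - k" and d: "k \<le> A - a + (B - b)"
        using True ab AB k i by auto
      have "R r = of_nat (if r \<le> a \<and> r \<le> B - b then (i choose (a - r)) * (D - i choose (B - b - r)) else 0)"
        if "r \<le> k" for r
      proof (cases "r \<le> a \<and> r \<le> B - b \<and> a - r \<le> i \<and> B - b - r \<le> D - i")
        case c: True
        have "R r = (\<Sum>s\<le>i. \<Sum>u\<le>D - i. if s = i - (a - r) \<and> u = B - b - r
           then of_nat ((i choose s) * (D - i choose u)) else 0)"
          unfolding R_def
        proof (intro sum.cong refl if_cong)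
          fix s u assume "s \<in> {..i}" "u \<in> {..D - i}"
          then show "(s + u = \<beta> \<and> a = i - s + r \<and> b = s + (k - r)) = (s = i - (a - r) \<and> u = B - b - r)"
            using c True ab AB B i that by auto
        qed
        also have "\<dots> = (\<Sum>s\<le>i. if s = i - (a - r) then of_nat ((i choose s) * (D - i choose (B - b - r))) else 0)"
        proof (rule sum.cong[OF refl])
          fix s
          show "(\<Sum>u\<le>D - i. if s = i - (a - r) \<and> u = B - b - r then of_nat ((i choose s) * (D - i choose u)) else 0)
            = (if s = i - (a - r) then of_nat ((i choose s) * (D - i choose (B - b - r))) else (0::complex))"
            using c by (cases "s = i - (a - r)") simp_all
        qed
        also have "\<dots> = of_nat ((i choose (i - (a - r))) * (D - i choose (B - b - r)))"
          by simp
        also have "(i choose (i - (a - r))) = (i choose (a - r))"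
          using c by (intro binomial_symmetric[symmetric]) auto
        finally show ?thesis using c by simp
      next
        case c: False
        have "R r = 0" unfolding R_def
        proof (intro sum.neutral ballI)
          fix s u assume "s \<in> {..i}" "u \<in> {..D - i}"
          then show "(if s + u = \<beta> \<and> a = i - s + r \<and> b = s + (k - r)
             then of_nat ((i choose s) * (D - i choose u)) else (0::complex)) = 0"
            using c True ab AB B i that by auto
        qed
        then show ?thesis using c by (auto simp: binomial_eq_0_iff)
      qed
      then have "(\<Sum>r\<le>k. (-1) ^ r * of_nat (k choose r) * R r)
        = (\<Sum>r\<le>k. (-1) ^ r * of_nat (k choose r) *
            of_nat (if r \<le> a \<and> r \<le> B - b then (i choose (a - r)) * (D - i choose (B - b - r)) else 0))"
        by (intro sum.cong refl) simp
      also have "\<dots> = of_int (cg_sum k a b (A - a) (B - b))"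
        unfolding cg_sum_def of_int_sum unfolding ik(2) unfolding ik(1) by (intro sum.cong refl) (simp add: mult_ac)
      finally show ?thesis using True by simp
    next
      case False
      have "R r = 0" if "r \<le> k" for r unfolding R_def
      proof (intro sum.neutral ballI)
        fix s u assume "s \<in> {..i}" "u \<in> {..D - i}"
        then show "(if s + u = \<beta> \<and> a = i - s + r \<and> b = s + (k - r)
           then of_nat ((i choose s) * (D - i choose u)) else (0::complex)) = 0"
          using False that by auto
      qed
      then show ?thesis using False by simp
    qed
    finally show "(\<Sum>r\<le>k. \<Sum>s\<le>i. \<Sum>u\<le>D - i. if s + u = \<beta> \<and> a = i - s + r \<and> b = s + (k - r) then
      ((-1) ^ r * of_nat ((k choose r) * (i choose s) * (D - i choose u))) * m a b else 0)
      = (if a + b = i + k then of_int (cg_sum k a b (A - a) (B - b)) else 0) * m a b" .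
  qed
  finally show "cg_map B D k (hmono D i) ((x1, y1), (x2, y2)) = (\<Sum>a\<le>A. \<Sum>b\<le>B.
    (if a + b = i + k then of_int (cg_sum k a b (A - a) (B - b)) else 0) * hmono A a (x1, y1) * hmono B b (x2, y2))"
    by (simp add: m_def mult.assoc)
qed

lemma cg_map_in_tensor_space:
  assumes AB: "A + B = D + 2 * k" and k: "k \<le> A" "k \<le> B" and P: "P \<in> hpolys (real D / 2)"
  shows "cg_map B D k P \<in> tensor_space (real A / 2) (real B / 2)"
proof -
  have "cg_map B D k P = (\<lambda>z. \<Sum>i\<le>D. hcoeff D P i * cg_map B D k (hmono D i) z)"
    by (subst hpolys_expand[OF P])
       (auto simp: cg_map_def dft_coeff_sum dft_coeff_cmult sum_distrib_left fun_eq_iff mult_ac)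
  moreover have "cg_map B D k (hmono D i) \<in> tensor_space (real A / 2) (real B / 2)" if "i \<le> D" for i
    unfolding mem_tensor_space_iff cg_map_hmono[OF AB k that]
    by (rule exI[where x = "\<lambda>a b. if a + b = i + k then of_int (cg_sum k a b (A - a) (B - b)) else 0"]) simp
  ultimately show ?thesis
    using tensor_space_sum[of "{..D}" "\<lambda>i. cg_map B D k (hmono D i)" A B "hcoeff D P"] by simp
qed

text \<open>
  The inverse of the norm of the image of \<open>y^D\<close> under \<open>cg_map\<close>, which is
  \<open>D choose (B - k)\<close> times \<open>(x2 y1 - x1 y2)^k y1^(A - k) y2^(B - k)\<close>.
\<close>

definition cg_scale :: "nat \<Rightarrow> nat \<Rightarrow> nat \<Rightarrow> nat \<Rightarrow> real" where
  "cg_scale A B D k = 1 / (sqrt (highest_weight_norm_sq A B k) * real (D choose (B - k)))"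

text \<open>
  Restricted to \<open>V\<^sub>l\<close>, so that the value elsewhere is the one prescribed by \<open>\<rightarrow>\<^sub>E\<close>.
\<close>

definition cg_embedding :: "nat \<Rightarrow> nat \<Rightarrow> nat \<Rightarrow> nat \<Rightarrow> (complex \<times> complex \<Rightarrow> complex)
    \<Rightarrow> (complex \<times> complex) \<times> (complex \<times> complex) \<Rightarrow> complex" where
  "cg_embedding A B D k = restrict
     (\<lambda>P z. of_real (cg_scale A B D k) * cg_map B D k P z) (hpolys (real D / 2))"

lemma intertwiner_cg_embedding:
  assumes AB: "A + B = D + 2 * k" and k: "k \<le> A" "k \<le> B"
  shows "intertwiner A B D (cg_embedding A B D k)"
  unfolding intertwiner_def
proof (intro conjI ballI allI)
  let ?\<Phi> = "cg_embedding A B D k"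
  show "?\<Phi> \<in> hpolys (real D / 2) \<rightarrow> tensor_space (real A / 2) (real B / 2)"
  proof
    fix P assume P: "P \<in> hpolys (real D / 2)"
    show "?\<Phi> P \<in> tensor_space (real A / 2) (real B / 2)"
      using tensor_space_sum[of "{()}" "\<lambda>_. cg_map B D k P" A B] cg_map_in_tensor_space[OF AB k P] P
      by (simp add: cg_embedding_def)
  qed
  show "?\<Phi> (\<lambda>p. s * P p + t * Q p) = (\<lambda>z. s * ?\<Phi> P z + t * ?\<Phi> Q z)"
    if "P \<in> hpolys (real D / 2)" "Q \<in> hpolys (real D / 2)" for P Q s t
    using that hpolys_lincomb[OF that, of s t]
    by (simp add: cg_embedding_def cg_map_linear distrib_left mult_ac)
  show "?\<Phi> (act g P) = tensor_act g (?\<Phi> P)" if "g \<in> SU2" "P \<in> hpolys (real D / 2)" for g P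
    using that act_in_hpolys[OF that(2), of g] cg_map_equivariant[OF that(1), of B D k P]
    by (auto simp: cg_embedding_def tensor_act_def fun_eq_iff)
qed

lemma matrix_coeff_cg_embedding:
  assumes AB: "A + B = D + 2 * k" and k: "k \<le> A" "k \<le> B" and i: "i \<le> D" and a: "a \<le> A" and b: "b \<le> B"
  shows "matrix_coeff A B D (cg_embedding A B D k) i a b
    = of_real (cg_scale A B D k) *
      (if a + b = i + k then of_int (cg_sum k a b (A - a) (B - b)) else 0)"
proof -
  have "matrix_coeff A B D (cg_embedding A B D k) i a b
    = of_real (cg_scale A B D k) * tcoeff A B (cg_map B D k (hmono D i)) a b"
    using hmono_in_hpolys[OF i] by (simp add: matrix_coeff_def cg_embedding_def tcoeff_def dft_coeff_cmult)
  then show ?thesis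
    unfolding cg_map_hmono[OF AB k i] tcoeff_sum[OF a b] .
qed

lemma cg_embedding_highest_weight:
  assumes AB: "A + B = D + 2 * k" and k: "k \<le> A" "k \<le> B"
  shows "matrix_coeff A B D (cg_embedding A B D k) 0 0 k = of_real (1 / sqrt (highest_weight_norm_sq A B k))"
proof -
  have "cg_sum k 0 k A (B - k) = (\<Sum>s\<le>k. if s = 0 then int (D choose (B - k)) else 0)"
    unfolding cg_sum_def using AB k by (intro sum.cong refl) auto
  moreover have "D choose (B - k) \<noteq> 0"
    using AB k by (simp add: binomial_eq_0_iff)
  ultimately show ?thesis
    using matrix_coeff_cg_embedding[OF AB k, of 0 0 k] k by (simp add: cg_scale_def)
qed

lemma is_CG_embedding_cg_embedding:
  assumes AB: "A + B = D + 2 * k" and k: "k \<le> A" "k \<le> B"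
  shows "is_CG_embedding (real A / 2) (real B / 2) (real D / 2) (cg_embedding A B D k)"
proof -
  let ?\<Phi> = "cg_embedding A B D k" and ?S = "highest_weight_norm_sq A B k"
  note int = intertwiner_cg_embedding[OF AB k]
  have S: "?S > 0" by (rule highest_weight_norm_sq_pos[OF k])
  have "1 / sqrt ?S * (1 / sqrt ?S) * ?S = 1"
    using S by (simp add: field_simps)
  then have "complex_of_real (1 / sqrt ?S * (1 / sqrt ?S) * ?S) = 1"
    by (simp only: of_real_1)
  then have norm: "coeff_inner A B (matrix_coeff A B D ?\<Phi> 0) (matrix_coeff A B D ?\<Phi> 0) = 1"
    unfolding intertwiner_highest_weight_norm[OF int AB k] cg_embedding_highest_weight[OF AB k]
    by (simp only: of_real_mult complex_cnj_complex_of_real)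
  have "inner_tensor (real A / 2) (real B / 2) (?\<Phi> (psi (real D / 2) (real D / 2)))
      (psi (real A / 2) (real A / 2) \<otimes>\<^sub>t psi (real B / 2) (real D / 2 - real A / 2))
      = of_real (1 / sqrt ?S * (sqrt (real (B choose k)) / real (B choose k)))"
    unfolding intertwiner_inner_highest[OF int AB k] cg_embedding_highest_weight[OF AB k] by simp
  moreover have "1 / sqrt ?S * (sqrt (real (B choose k)) / real (B choose k)) > 0"
    using S k by simp
  moreover have "?\<Phi> \<in> extensional (hpolys (real D / 2))"
    by (simp add: cg_embedding_def)
  ultimately show ?thesis
    using int intertwiner_inner[OF int AB]
    unfolding is_CG_embedding_def intertwiner_def Let_def PiE_def norm
    by (simp del: of_real_mult of_real_divide)
qed

lemma CG_embedding_eq: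
  assumes AB: "A + B = D + 2 * k" and k: "k \<le> A" "k \<le> B"
  shows "CG_embedding (real A / 2) (real B / 2) (real D / 2) = cg_embedding A B D k"
  unfolding CG_embedding_def
proof (rule the_equality)
  show CG: "is_CG_embedding (real A / 2) (real B / 2) (real D / 2) (cg_embedding A B D k)"
    by (rule is_CG_embedding_cg_embedding[OF AB k])
  fix \<Phi> assume \<Phi>: "is_CG_embedding (real A / 2) (real B / 2) (real D / 2) \<Phi>"
  note int = is_CG_embedding_imp_intertwiner[OF \<Phi>] and int' = is_CG_embedding_imp_intertwiner[OF CG]
  have eq: "\<Phi> P = cg_embedding A B D k P" if "P \<in> hpolys (real D / 2)" for P
  proof (rule intertwiner_eqI[OF int int' _ that])
    fix a b assume "a \<le> A" "b \<le> B"
    then show "matrix_coeff A B D \<Phi> 0 a b = matrix_coeff A B D (cg_embedding A B D k) 0 a b"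
      by (simp only: intertwiner_highest_weight[OF int AB k] intertwiner_highest_weight[OF int' AB k]
        CG_embedding_highest_weight[OF \<Phi> AB k] CG_embedding_highest_weight[OF CG AB k])
  qed
  have "\<Phi> \<in> extensional (hpolys (real D / 2))"
    using \<Phi> unfolding is_CG_embedding_def by (auto simp: PiE_def)
  moreover have "cg_embedding A B D k \<in> extensional (hpolys (real D / 2))"
    by (simp add: cg_embedding_def)
  ultimately show "\<Phi> = cg_embedding A B D k"
    using eq by (rule extensionalityI)
qed

text \<open>
  The square roots of binomial coefficients convert between the monomials and the orthonormal bases
  \<open>psi\<close>.
\<close>

lemma clebsch_gordan_eq_cg_sum:
  assumes AB: "A + B = D + 2 * k" and k: "k \<le> A" "k \<le> B" and i: "i \<le> D" and a: "a \<le> A" and b: "b \<le> B"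
    and weight: "a + b = i + k"
  shows "clebsch_gordan (real A / 2) (real B / 2) (real D / 2)
      (real A / 2 - real a) (real B / 2 - real b) (real D / 2 - real i)
    = of_real (sqrt (real (D choose i)) / (sqrt (highest_weight_norm_sq A B k) * real (D choose (B - k)) * sqrt (real (A choose a)) * sqrt (real (B choose b)))
       * real_of_int (cg_sum k a b (A - a) (B - b)))"
proof -
  let ?\<Phi> = "cg_embedding A B D k" and ?s = "complex_of_real (sqrt (real (D choose i)))"
  note int = intertwiner_cg_embedding[OF AB k]
  have mem: "psi (real D / 2) (real D / 2 - real i) \<in> hpolys (real D / 2)"
    unfolding psi_eq[OF i] using hpolys_lincomb[of "hmono D i" D "hmono D i" ?s 0] hmono_in_hpolys[OF i] by simp
  have "?\<Phi> (psi (real D / 2) (real D / 2 - real i)) = (\<lambda>z. ?s * ?\<Phi> (hmono D i) z)"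
    unfolding psi_eq[OF i] using intertwiner_lincomb[OF int, of "{i}" "hmono D" "\<lambda>_. ?s"] hmono_in_hpolys[OF i] by simp
  then have "tcoeff A B (?\<Phi> (psi (real D / 2) (real D / 2 - real i))) a b = ?s * matrix_coeff A B D ?\<Phi> i a b"
    by (simp add: tcoeff_def dft_coeff_cmult matrix_coeff_def)
  moreover have "?\<Phi> (psi (real D / 2) (real D / 2 - real i)) \<in> tensor_space (real A / 2) (real B / 2)"
    using int mem unfolding intertwiner_def by auto
  ultimately have "clebsch_gordan (real A / 2) (real B / 2) (real D / 2)
      (real A / 2 - real a) (real B / 2 - real b) (real D / 2 - real i)
      = ?s * matrix_coeff A B D ?\<Phi> i a b / (of_real (sqrt (real (A choose a))) * of_real (sqrt (real (B choose b))))"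
    unfolding clebsch_gordan_def phi_def CG_embedding_eq[OF AB k] by (simp add: coord_psi_tensor a b)
  then show ?thesis
    unfolding matrix_coeff_cg_embedding[OF AB k i a b] using weight by (simp add: cg_scale_def)
qed

section \<open>The normalisation constant and the formula for the coefficients\<close>

text \<open>
  After cancelling factorials the sum is Vandermonde's convolution of rising factorials.
\<close>

lemma highest_weight_norm_sq_eq:
  "highest_weight_norm_sq (\<alpha> + k) (\<beta> + k) k
    = fact k * fact \<alpha> * fact \<beta> * fact (\<alpha> + \<beta> + k + 1) / (fact (\<alpha> + \<beta> + 1) * fact (\<alpha> + k) * fact (\<beta> + k))"
proof -
  have poch: "fact n * pochhammer (real n + 1) r = fact (n + r)" for n r
    using pochhammer_product[of n "n + r" "1::real"] by (simp add: pochhammer_fact[symmetric] add.commute)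
  have "highest_weight_norm_sq (\<alpha> + k) (\<beta> + k) k = (\<Sum>a\<le>k. fact k * fact \<alpha> * fact \<beta> / (fact (\<alpha> + k) * fact (\<beta> + k)) *
      (real (k choose a) * pochhammer (real \<beta> + 1) a * pochhammer (real \<alpha> + 1) (k - a)))"
    unfolding highest_weight_norm_sq_def
  proof (intro sum.cong refl)
    fix a assume "a \<in> {..k}"
    then have a: "a \<le> k" by simp
    have 1: "real (k choose a) = fact k / (fact a * fact (k - a))"
      using a by (rule binomial_fact)
    have 2: "real (\<alpha> + k choose a) = fact (\<alpha> + k) / (fact a * (fact \<alpha> * pochhammer (real \<alpha> + 1) (k - a)))"
      using a binomial_fact[of a "\<alpha> + k", where ?'a = real] by (simp add: poch)
    have "\<beta> + k - (k - a) = \<beta> + a" using a by simp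
    then have 3: "real (\<beta> + k choose (k - a)) = fact (\<beta> + k) / (fact (k - a) * (fact \<beta> * pochhammer (real \<beta> + 1) a))"
      using a binomial_fact[of "k - a" "\<beta> + k", where ?'a = real] by (simp add: poch)
    have nz: "pochhammer (real \<alpha> + 1) (k - a) > 0" "pochhammer (real \<beta> + 1) a > 0"
      by (auto intro!: pochhammer_pos)
    show "(real (k choose a))\<^sup>2 / (real (\<alpha> + k choose a) * real (\<beta> + k choose (k - a)))
      = fact k * fact \<alpha> * fact \<beta> / (fact (\<alpha> + k) * fact (\<beta> + k)) *
      (real (k choose a) * pochhammer (real \<beta> + 1) a * pochhammer (real \<alpha> + 1) (k - a))"
      unfolding 2 3 1 using nz by (simp add: field_simps power2_eq_square)
  qed
  also have "\<dots> = fact k * fact \<alpha> * fact \<beta> / (fact (\<alpha> + k) * fact (\<beta> + k)) * pochhammer (real (\<alpha> + \<beta> + 1) + 1) k"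
    unfolding sum_distrib_left[symmetric] pochhammer_binomial_sum[symmetric] by (simp add: add_ac)
  also have "pochhammer (real (\<alpha> + \<beta> + 1) + 1) k = fact (\<alpha> + \<beta> + k + 1) / fact (\<alpha> + \<beta> + 1)"
    using poch[of "\<alpha> + \<beta> + 1" k] by (simp add: field_simps del: fact_Suc) 
  finally show ?thesis by simp
qed

text \<open>
  Both sides are square roots of the same positive rational number.
\<close>

lemma normalisation_constant:
  fixes a b c d k i i' \<alpha> \<beta> D :: nat
  assumes "a + b = i + k" "c + d = i' + k" "a + c = \<alpha> + k" "b + d = \<beta> + k" "D = i + i'"
  shows "sqrt (real (D choose i)) / (sqrt (highest_weight_norm_sq (a + c) (b + d) k) * real (D choose \<beta>)
       * sqrt (real (a + c choose a)) * sqrt (real (b + d choose b)))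
    = sqrt (fact i * fact i' * fact \<beta> * fact \<alpha> * real (D + 1)
        / (fact b * fact a * fact c * fact d * fact (D + k + 1) * fact k))
      * (fact a * fact b * fact c * fact d / (fact i * fact i'))"
proof -
  have D: "D = \<alpha> + \<beta>" using assms by linarith
  have 1: "real (D choose i) = fact D / (fact i * fact i')"
    using assms binomial_fact[of i D, where ?'a = real] by simp
  have 2: "real (D choose \<beta>) = fact D / (fact \<beta> * fact \<alpha>)"
    using D binomial_fact[of \<beta> D, where ?'a = real] by simp
  have 3: "real (a + c choose a) = fact (a + c) / (fact a * fact c)"
    using binomial_fact[of a "a + c", where ?'a = real] by simp
  have 4: "real (b + d choose b) = fact (b + d) / (fact b * fact d)"
    using binomial_fact[of b "b + d", where ?'a = real] by simp
  have 5: "highest_weight_norm_sq (a + c) (b + d) k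
    = fact k * fact \<alpha> * fact \<beta> * fact (D + k + 1) / (real (D + 1) * fact D * fact (a + c) * fact (b + d))"
    unfolding assms highest_weight_norm_sq_eq D[unfolded assms(5)] by (simp add: algebra_simps)
  have "sqrt (real (D choose i)) / (sqrt (highest_weight_norm_sq (a + c) (b + d) k) * real (D choose \<beta>)
       * sqrt (real (a + c choose a)) * sqrt (real (b + d choose b)))
    = sqrt (real (D choose i) / (highest_weight_norm_sq (a + c) (b + d) k * (real (D choose \<beta>))\<^sup>2
       * real (a + c choose a) * real (b + d choose b)))"
    by (simp add: real_sqrt_mult real_sqrt_divide)
  also have "real (D choose i) / (highest_weight_norm_sq (a + c) (b + d) k * (real (D choose \<beta>))\<^sup>2
       * real (a + c choose a) * real (b + d choose b))
     = fact i * fact i' * fact \<beta> * fact \<alpha> * real (D + 1)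
        / (fact b * fact a * fact c * fact d * fact (D + k + 1) * fact k)
      * (fact a * fact b * fact c * fact d / (fact i * fact i'))\<^sup>2"
    unfolding 1 2 3 4 5 power2_eq_square by (simp add: divide_simps del: fact_Suc of_nat_add)
  also have "sqrt \<dots> = sqrt (fact i * fact i' * fact \<beta> * fact \<alpha> * real (D + 1)
        / (fact b * fact a * fact c * fact d * fact (D + k + 1) * fact k))
      * (fact a * fact b * fact c * fact d / (fact i * fact i'))"
    unfolding real_sqrt_mult[of _ "_\<^sup>2"] real_sqrt_abs by simp
  finally show ?thesis .
qed

text \<open>
  The formula in terms of the four exponents \<open>a, c, b, d\<close> of \<open>x1, y1, x2, y2\<close>, which makes all
  constraints on the parameters symmetric: the two column sums and the two row sums are at least \<open>k\<close>.
\<close>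

lemma clebsch_gordan_nat:
  fixes a b c d k :: nat
  assumes k: "k \<le> a + b" "k \<le> c + d" "k \<le> a + c" "k \<le> b + d"
  defines "i \<equiv> a + b - k" and "i' \<equiv> c + d - k"
  shows "clebsch_gordan (real (a + c) / 2) (real (b + d) / 2) (real (i + i') / 2)
      (real (a + c) / 2 - real a) (real (b + d) / 2 - real b) (real (i + i') / 2 - real i)
    = of_real ((-1) ^ k *
        sqrt (fact i * fact i' * fact (b + d - k) * fact (a + c - k) * real (i + i' + 1)
          / (fact b * fact a * fact c * fact d * fact (i + i' + k + 1) * fact k))
        * real_of_int (hahn (int k) (int c + int d) (int a + int b) (int b + int d) (int d)))"
proof -
  have sum: "a + b = i + k" "c + d = i' + k" "a + c = (a + c - k) + k" "b + d = (b + d - k) + k"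
    using k by (auto simp: i_def i'_def)
  have "(-1) ^ k * (-1) ^ k = (1::real)" by (simp flip: power_add)
  then have "(-1) ^ k * x * ((-1) ^ k * y * z) = x * y * z" for x y z :: real
    by (metis (no_types, opaque_lifting) mult.assoc mult.commute mult.right_neutral)
  then have rhs: "(-1) ^ k *
        sqrt (fact i * fact i' * fact (b + d - k) * fact (a + c - k) * real (i + i' + 1)
          / (fact b * fact a * fact c * fact d * fact (i + i' + k + 1) * fact k))
        * real_of_int (hahn (int k) (int c + int d) (int a + int b) (int b + int d) (int d))
      = sqrt (real (i + i' choose i)) / (sqrt (highest_weight_norm_sq (a + c) (b + d) k) * real (i + i' choose (b + d - k))
       * sqrt (real (a + c choose a)) * sqrt (real (b + d choose b))) * real_of_int (cg_sum k a b c d)"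
    unfolding real_hahn_eq_cg_sum[OF k] normalisation_constant[OF sum refl]
      i_def[symmetric] i'_def[symmetric] .
  have "a + c + (b + d) = i + i' + 2 * k" using sum by linarith
  from clebsch_gordan_eq_cg_sum[OF this k(3,4), of i a b] sum(1)
  show ?thesis unfolding rhs by simp
qed

theorem theorem4p4:
  fixes n m h k w :: int
  assumes "0 \<le> m" "m \<le> n" "0 \<le> h" "h \<le> n"
    and "0 \<le> k" "k \<le> Min {n - m, m, n - h, h}"
    and "max 0 (m - h) \<le> w" "w \<le> min (n - h) m"
  shows "clebsch_gordan
      (real_of_int (n - m) / 2) (real_of_int m / 2) (real_of_int n / 2 - real_of_int k)
      (real_of_int (n + m) / 2 - real_of_int h - real_of_int w)
      (real_of_int w - real_of_int m / 2)
      (real_of_int n / 2 - real_of_int h)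
    = complex_of_real
      ((-1) ^ nat k *
       sqrt ((fact (nat (h - k)) * fact (nat (n - h - k)) * fact (nat (m - k)) * fact (nat (n - m - k))
                * real_of_int (n - 2 * k + 1))
             / (fact (nat (m - w)) * fact (nat (h - m + w)) * fact (nat (n - h - w)) * fact (nat w)
                * fact (nat (n - k + 1)) * fact (nat k)))
       * real_of_int (hahn k (n - h) h m w))"
proof -
  have bounds: "k \<le> n - m" "k \<le> m" "k \<le> n - h" "k \<le> h" "0 \<le> w" "m - h \<le> w" "w \<le> n - h" "w \<le> m"
    using assms by auto
  \<comment> \<open>The exponents of \<open>x1, x2, y1, y2\<close> in \<open>psi l1 j1 \<otimes>\<^sub>t psi l2 j2\<close> are \<open>l1 - j1, l2 - j2, l1 + j1, l2 + j2\<close>.\<close>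
  define a b c d K where "a = nat (h - m + w)" "b = nat (m - w)" "c = nat (n - h - w)" "d = nat w" "K = nat k"
  note nat_defs = this
  have ints: "int a = h - m + w" "int b = m - w" "int c = n - h - w" "int d = w" "int K = k"
    using assms(5) bounds by (auto simp: nat_defs)
  have K: "K \<le> a + b" "K \<le> c + d" "K \<le> a + c" "K \<le> b + d"
    using ints bounds by linarith+
  have m: "m = int b + int d" and h: "h = int a + int b" and n: "n = int a + int b + int c + int d"
    and w: "w = int d" and k: "k = int K"
    using ints by auto
  have nats: "nat (h - k) = a + b - K" "nat (n - h - k) = c + d - K" "nat (m - k) = b + d - K" "nat (n - m - k) = a + c - K"
    "nat (m - w) = b" "nat (h - m + w) = a" "nat (n - h - w) = c" "nat w = d" "nat k = K"
    "nat (n - k + 1) = (a + b - K) + (c + d - K) + K + 1"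
    using K unfolding m h n w k by auto
  have spins: "real_of_int (n - m) / 2 = real (a + c) / 2" "real_of_int m / 2 = real (b + d) / 2"
    "real_of_int n / 2 - real_of_int k = real ((a + b - K) + (c + d - K)) / 2"
    "real_of_int (n + m) / 2 - real_of_int h - real_of_int w = real (a + c) / 2 - real a"
    "real_of_int w - real_of_int m / 2 = real (b + d) / 2 - real b"
    "real_of_int n / 2 - real_of_int h = real ((a + b - K) + (c + d - K)) / 2 - real (a + b - K)"
    "real_of_int (n - 2 * k + 1) = real ((a + b - K) + (c + d - K) + 1)"
    using K unfolding m h n w k by (auto simp: of_nat_diff field_simps)
  have hahn: "hahn k (n - h) h m w = hahn (int K) (int c + int d) (int a + int b) (int b + int d) (int d)"
    unfolding m h n w k by simp
  show ?thesis
    unfolding nats hahn unfolding spins(3-7) unfolding spins(1,2) by (rule clebsch_gordan_nat[OF K])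
qed

end
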